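(* Let $0\le k\le n$ and let $\mathsf{N}_1,\dots,\mathsf{N}_s$ be a set of representatives of the isomorphism classes of graphic Schubert matroids of rank $k$ on $n$ elements. Then for every matroid $\mathsf{M}$ of rank $k$ on $n$ elements there exist unique integers $c_1,\dots,c_s$ such that $T_{\mathsf{M}}(x,y)=\sum_{i=1}^s c_i\,T_{\mathsf{N}_i}(x,y)$.
   Context: $T_{\mathsf{M}}(x,y)$ is the Tutte polynomial. A matroid is Schubert (nested) if its lattice of cyclic flats is a chain. *)

theory Defs
  imports "HOL-Computational_Algebra.Polynomial"
begin

definition matroid :: "nat \<Rightarrow> nat set set \<Rightarrow> bool" where
  "matroid n I \<longleftrightarrow>
     {} \<in> I \<and>
     (\<forall>A\<in>I. A \<subseteq> {..<n}) \<and>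
     (\<forall>A B. A \<in> I \<longrightarrow> B \<subseteq> A \<longrightarrow> B \<in> I) \<and>
     (\<forall>A B. A \<in> I \<longrightarrow> B \<in> I \<longrightarrow> card A < card B \<longrightarrow> (\<exists>e\<in>B - A. insert e A \<in> I))"

definition mrank :: "nat set set \<Rightarrow> nat set \<Rightarrow> nat" where
  "mrank I A = Max (card ` {B \<in> I. B \<subseteq> A})"

definition matroid_rank :: "nat \<Rightarrow> nat set set \<Rightarrow> nat" where
  "matroid_rank n I = mrank I {..<n}"

definition circuit :: "nat \<Rightarrow> nat set set \<Rightarrow> nat set \<Rightarrow> bool" where
  "circuit n I C \<longleftrightarrow> C \<subseteq> {..<n} \<and> C \<notin> I \<and> (\<forall>x\<in>C. C - {x} \<in> I)"

definition flat :: "nat \<Rightarrow> nat set set \<Rightarrow> nat set \<Rightarrow> bool" where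
  "flat n I F \<longleftrightarrow> F \<subseteq> {..<n} \<and> (\<forall>e\<in>{..<n} - F. mrank I (insert e F) > mrank I F)"

definition cyclic :: "nat \<Rightarrow> nat set set \<Rightarrow> nat set \<Rightarrow> bool" where
  "cyclic n I F \<longleftrightarrow> F = \<Union>{C. circuit n I C \<and> C \<subseteq> F}"

definition cyclic_flat :: "nat \<Rightarrow> nat set set \<Rightarrow> nat set \<Rightarrow> bool" where
  "cyclic_flat n I F \<longleftrightarrow> flat n I F \<and> cyclic n I F"

definition schubert :: "nat \<Rightarrow> nat set set \<Rightarrow> bool" where
  "schubert n I \<longleftrightarrow>
     (\<forall>F G. cyclic_flat n I F \<longrightarrow> cyclic_flat n I G \<longrightarrow> F \<subseteq> G \<or> G \<subseteq> F)"

text \<open>Multigraph (loops and parallel edges allowed) with edge set {0..<n}; edge e joins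
  the vertices fst (ends e) and snd (ends e). An edge set contains a cycle if some distinct
  edges e_0..e_{m-1} and distinct vertices v_0..v_{m-1} (m \<ge> 1) satisfy that e_i joins
  v_i and v_{(i+1) mod m}.\<close>
definition has_cycle :: "(nat \<Rightarrow> nat \<times> nat) \<Rightarrow> nat set \<Rightarrow> bool" where
  "has_cycle ends A \<longleftrightarrow>
     (\<exists>es vs. length es = length vs \<and> length es \<ge> 1 \<and> distinct es \<and> distinct vs \<and>
        set es \<subseteq> A \<and>
        (\<forall>i<length es. {fst (ends (es ! i)), snd (ends (es ! i))}
                        = {vs ! i, vs ! ((i + 1) mod length es)}))"

definition graphic :: "nat \<Rightarrow> nat set set \<Rightarrow> bool" where
  "graphic n I \<longleftrightarrow>
     (\<exists>ends :: nat \<Rightarrow> nat \<times> nat. \<forall>A. A \<subseteq> {..<n} \<longrightarrow> (A \<in> I \<longleftrightarrow> \<not> has_cycle ends A))"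

definition matroid_iso :: "nat \<Rightarrow> nat set set \<Rightarrow> nat set set \<Rightarrow> bool" where
  "matroid_iso n I J \<longleftrightarrow>
     (\<exists>f. bij_betw f {..<n} {..<n} \<and> (\<forall>A. A \<subseteq> {..<n} \<longrightarrow> (A \<in> I \<longleftrightarrow> f ` A \<in> J)))"

text \<open>Tutte polynomial in Z[x,y], represented as int poly poly: the inner variable is x,
  the outer variable is y.\<close>
definition tutte :: "nat \<Rightarrow> nat set set \<Rightarrow> int poly poly" where
  "tutte n I = (\<Sum>A\<in>Pow {..<n}.
      [:[:-1, 1:]:] ^ (mrank I {..<n} - mrank I A) * [:[:-1:], 1:] ^ (card A - mrank I A))"

end

theory Submission
  imports Defs
begin

text \<open>
  Write \<open>u = x - 1\<close> and \<open>v = y - 1\<close>. In a graphic Schubert matroid the closures of circuits form a chain,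
  and symmetric differences of circuits are dependent; this forces the shape of the matroid: a
  circuit in which one edge is replaced by a parallel class, plus loops and coloops. Given \<open>k\<close> and
  \<open>n\<close>, such a matroid is determined by the number \<open>r\<close> of path edges and the size \<open>m\<close> of the parallel
  class, with \<open>1 \<le> r \<le> k\<close> and \<open>1 \<le> m \<le> n - k\<close>, or has loops and coloops only. Its Tutte polynomial satisfies
  \<open>T = x\<^sup>k y\<^bsup>n-k\<^esup> + (1 - uv) (x\<^bsup>k-r\<^esup> + \<dots> + x\<^bsup>k-1\<^esup>) (y\<^bsup>n-k-m\<^esup> + \<dots> + y\<^bsup>n-k-1\<^esup>)\<close>.
  These corner sums form a basis over the integers of the polynomials \<open>q\<close> of degree less than \<open>k\<close> in \<open>x\<close>
  and less than \<open>n - k\<close> in \<open>y\<close>. Finally \<open>T\<^sub>M - x\<^sup>k y\<^bsup>n-k\<^esup>\<close> is of the form \<open>(1 - uv) q\<close> for every \<open>M\<close>: compare the two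
  corank-nullity sums subset by subset.
\<close>


section \<open>Circuits and closures\<close>

text \<open>On the hyperbola \<open>u v = 1\<close> each summand
  \<open>u^(k - r(A)) v^(|A| - r(A))\<close> becomes \<open>u^(k - |A|)\<close>, whatever the rank
  function \<open>r\<close>. All matroids of rank k on n elements therefore agree there, which
  explains the factor \<open>1 - u v\<close>; and \<open>x^k y^(n-k)\<close> belongs to k coloops
  and n - k loops. Coranks are at most k and nullities at most n - k, so the cofactor q has k (n -
  k) coefficients; with the reference matroid this is exactly the number of shapes. Integrality
  holds because mixed second differences of the corner sums are single monomials. The closed formula
  is proved after multiplication by \<open>u v\<close>, which turns geometric sums into differences
  of powers and can be cancelled in an integral domain. In the classification, a non-loop in the
  closure of a largest circuit cannot be a proper chord: it would split the circuit into two arcs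
  with incomparable closures. Independence of the polynomials does double duty: it gives uniqueness
  of the coefficients, and it tells shapes apart, so that the given representatives match the shapes
  bijectively.\<close>

lemma matroid_empty: "matroid n I \<Longrightarrow> {} \<in> I"
  by (simp add: matroid_def)

lemma matroid_subset: "matroid n I \<Longrightarrow> A \<in> I \<Longrightarrow> A \<subseteq> {..<n}"
  by (simp add: matroid_def)

lemma matroid_down: "matroid n I \<Longrightarrow> A \<in> I \<Longrightarrow> B \<subseteq> A \<Longrightarrow> B \<in> I"
  by (simp add: matroid_def)

lemma matroid_exchange:
  "matroid n I \<Longrightarrow> A \<in> I \<Longrightarrow> B \<in> I \<Longrightarrow> card A < card B \<Longrightarrow> \<exists>e\<in>B - A. insert e A \<in> I"
  by (simp add: matroid_def)

lemma matroid_finite: "matroid n I \<Longrightarrow> A \<in> I \<Longrightarrow> finite A"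
  by (rule finite_subset[OF matroid_subset finite_lessThan])

lemma finite_indep_subsets: "matroid n I \<Longrightarrow> finite {B \<in> I. B \<subseteq> A}"
  by (rule finite_subset[of _ "Pow {..<n}"]) (use matroid_subset in auto)

lemma card_le_mrank: "matroid n I \<Longrightarrow> B \<in> I \<Longrightarrow> B \<subseteq> A \<Longrightarrow> card B \<le> mrank I A"
  unfolding mrank_def by (rule Max_ge) (auto intro: finite_indep_subsets)

lemma mrank_attained:
  assumes "matroid n I"
  obtains B where "B \<in> I" "B \<subseteq> A" "card B = mrank I A"
proof -
  have "Max (card ` {B \<in> I. B \<subseteq> A}) \<in> card ` {B \<in> I. B \<subseteq> A}"
    by (rule Max_in) (use assms matroid_empty in \<open>auto intro: finite_indep_subsets\<close>)
  then show ?thesis using that unfolding mrank_def by auto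
qed

lemma mrank_le_card:
  assumes "matroid n I" "A \<subseteq> {..<n}"
  shows "mrank I A \<le> card A"
proof -
  obtain B where "B \<subseteq> A" "card B = mrank I A" using mrank_attained[OF assms(1)] by blast
  then show ?thesis using assms(2) card_mono[of A B] finite_subset by fastforce
qed

lemma mrank_mono:
  assumes "matroid n I" "A \<subseteq> B"
  shows "mrank I A \<le> mrank I B"
proof -
  obtain X where X: "X \<in> I" "X \<subseteq> A" "card X = mrank I A"
    using mrank_attained[OF assms(1)] by blast
  then show ?thesis using card_le_mrank[OF assms(1) X(1)] assms(2) by force
qed

text \<open>A basis of the ground set has at most \<open>n - card A\<close> elements outside
  \<open>A\<close>. This later limits the exponent of \<open>y - 1\<close>; sums replace truncated
  subtraction.\<close>

lemma nullity_bound: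
  assumes "matroid n I" "A \<subseteq> {..<n}"
  shows "card A + mrank I {..<n} \<le> n + mrank I A"
proof -
  obtain B where B: "B \<in> I" "B \<subseteq> {..<n}" "card B = mrank I {..<n}"
    using mrank_attained assms(1) by blast
  have fin: "finite A" "finite B" using assms(2) B(2) finite_subset by blast+
  have "card (B \<inter> A) \<le> mrank I A"
    using B matroid_down[OF assms(1)] card_le_mrank[OF assms(1)] by blast
  moreover have "card (A \<union> B) \<le> n"
    using card_mono[of "{..<n}" "A \<union> B"] assms(2) B(2) by simp
  moreover have "card A + card B = card (A \<union> B) + card (A \<inter> B)"
    using fin card_Un_Int by blast
  ultimately show ?thesis using B(3) by (simp add: Int_commute)
qed

lemma indep_extend:
  assumes "matroid n I" "B \<in> I" "B \<subseteq> A"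
  obtains B' where "B' \<in> I" "B \<subseteq> B'" "B' \<subseteq> A" "card B' = mrank I A"
proof -
  have "\<exists>B'. B' \<in> I \<and> B \<subseteq> B' \<and> B' \<subseteq> A \<and> card B' = mrank I A"
    using assms(2,3)
  proof (induction "mrank I A - card B" arbitrary: B rule: less_induct)
    case less
    show ?case
    proof (cases "card B = mrank I A")
      case True
      then show ?thesis using less.prems by blast
    next
      case False
      obtain D where D: "D \<in> I" "D \<subseteq> A" "card D = mrank I A"
        using mrank_attained assms(1) by blast
      have lt: "card B < mrank I A"
        using False card_le_mrank[OF assms(1) less.prems] by simp
      then obtain e where e: "e \<in> D - B" "insert e B \<in> I"
        using matroid_exchange[OF assms(1) less.prems(1) D(1)] D(3) by auto
      have "card (insert e B) = Suc (card B)"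
        using e(1) matroid_finite[OF assms(1) less.prems(1)] by simp
      then have "\<exists>B'. B' \<in> I \<and> insert e B \<subseteq> B' \<and> B' \<subseteq> A \<and> card B' = mrank I A"
        using lt e D(2) less.prems(2) by (intro less.hyps) auto
      then show ?thesis by blast
    qed
  qed
  then show ?thesis using that by blast
qed

lemma dependent_contains_circuit:
  assumes "A \<subseteq> {..<n}" "A \<notin> I"
  obtains C where "circuit n I C" "C \<subseteq> A"
proof -
  have "finite A" using assms(1) finite_subset by blast
  then have "\<exists>C. circuit n I C \<and> C \<subseteq> A" using assms
  proof (induction A rule: finite_psubset_induct)
    case (psubset A)
    show ?case
    proof (cases "\<forall>x\<in>A. A - {x} \<in> I")
      case True
      then show ?thesis using psubset.prems circuit_def by blast
    next
      case False
      then obtain x where x: "x \<in> A" "A - {x} \<notin> I" by blast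
      then have "\<exists>C. circuit n I C \<and> C \<subseteq> A - {x}"
        using psubset.IH[of "A - {x}"] psubset.prems by blast
      then show ?thesis by blast
    qed
  qed
  then show ?thesis using that by blast
qed

lemma circuit_proper_subset_indep:
  assumes "matroid n I" "circuit n I C" "X \<subset> C"
  shows "X \<in> I"
proof -
  obtain x where "x \<in> C" "X \<subseteq> C - {x}" using assms(3) by blast
  then show ?thesis using assms(1,2) matroid_down unfolding circuit_def by blast
qed

lemma circuit_finite: "circuit n I C \<Longrightarrow> finite C"
  unfolding circuit_def using finite_subset by blast

text \<open>If \<open>e\<close> raised the rank, a basis of \<open>F\<close> extending
  \<open>D - {e}\<close> could be augmented inside \<open>insert e F\<close>: either by
  \<open>e\<close>, making \<open>D\<close> independent, or inside \<open>F\<close>, beyond its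
  rank.\<close>

lemma flat_contains_circuit_end:
  assumes "matroid n I" "flat n I F" "circuit n I D" "e \<in> D" "D - {e} \<subseteq> F"
  shows "e \<in> F"
proof (rule ccontr)
  assume "e \<notin> F"
  moreover have "e < n" using assms(3,4) unfolding circuit_def by auto
  ultimately have gt: "mrank I F < mrank I (insert e F)"
    using assms(2) unfolding flat_def by auto
  have "D - {e} \<in> I" using assms(3,4) unfolding circuit_def by blast
  then obtain B where B: "B \<in> I" "D - {e} \<subseteq> B" "B \<subseteq> F" "card B = mrank I F"
    using indep_extend[OF assms(1) _ assms(5)] by blast
  obtain B' where B': "B' \<in> I" "B' \<subseteq> insert e F" "card B' = mrank I (insert e F)"
    using mrank_attained assms(1) by blast
  obtain x where x: "x \<in> B' - B" "insert x B \<in> I"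
    using matroid_exchange[OF assms(1) B(1) B'(1)] B(4) B'(3) gt by auto
  have cx: "card (insert x B) = Suc (card B)"
    using x matroid_finite[OF assms(1) B(1)] by simp
  show False
  proof (cases "x = e")
    case True
    then have "D \<in> I" using x(2) B(2) matroid_down[OF assms(1)] by blast
    then show False using assms(3) unfolding circuit_def by blast
  next
    case False
    then have "insert x B \<subseteq> F" using x(1) B'(2) B(3) by blast
    then have "card (insert x B) \<le> mrank I F" using card_le_mrank assms(1) x(2) by blast
    then show False using cx B(4) by simp
  qed
qed

text \<open>The closure of \<open>B\<close>, but only when \<open>B\<close> is independent.\<close>
definition mspan :: "nat \<Rightarrow> nat set set \<Rightarrow> nat set \<Rightarrow> nat set" where
  "mspan n I B = {x. x < n \<and> (x \<in> B \<or> insert x B \<notin> I)}"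

lemma indep_in_mspan_card:
  assumes "matroid n I" "B \<in> I" "B' \<in> I" "B' \<subseteq> mspan n I B"
  shows "card B' \<le> card B"
proof (rule ccontr)
  assume "\<not> card B' \<le> card B"
  then obtain e where "e \<in> B' - B" "insert e B \<in> I"
    using matroid_exchange[OF assms(1-3)] by auto
  then show False using assms(4) unfolding mspan_def by blast
qed

lemma circuit_subset_mspan:
  assumes "circuit n I C" "c \<in> C"
  shows "C \<subseteq> mspan n I (C - {c})"
  using assms unfolding circuit_def mspan_def by (auto simp: insert_absorb)

text \<open>Brings the Schubert condition to bear on circuits. Every further element
  \<open>x\<close> of the closure depends on \<open>C - {c}\<close>, and the circuit witnessing this
  passes through \<open>x\<close> and stays in the closure.\<close>

lemma cyclic_flat_mspan:
  assumes "matroid n I" "circuit n I C" "c \<in> C"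
  shows "cyclic_flat n I (mspan n I (C - {c}))"
proof -
  let ?B = "C - {c}" let ?S = "mspan n I ?B"
  have B: "?B \<in> I" using assms(2,3) unfolding circuit_def by blast
  have BS: "?B \<subseteq> ?S" using circuit_subset_mspan[OF assms(2,3)] by blast
  have rank: "mrank I ?S = card ?B"
  proof (rule antisym)
    obtain X where X: "X \<in> I" "X \<subseteq> ?S" "card X = mrank I ?S"
      using mrank_attained[OF assms(1)] by blast
    then show "mrank I ?S \<le> card ?B" using indep_in_mspan_card[OF assms(1) B X(1,2)] by simp
  qed (rule card_le_mrank[OF assms(1) B BS])
  have "flat n I ?S" unfolding flat_def
  proof (intro conjI ballI)
    show "?S \<subseteq> {..<n}" unfolding mspan_def by auto
    fix e assume e: "e \<in> {..<n} - ?S"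
    then have *: "insert e ?B \<in> I" "e \<notin> ?B" unfolding mspan_def by auto
    then have "card (insert e ?B) \<le> mrank I (insert e ?S)"
      using card_le_mrank[OF assms(1)] BS by blast
    then show "mrank I ?S < mrank I (insert e ?S)"
      using * rank matroid_finite[OF assms(1) B] by simp
  qed
  moreover have "cyclic n I ?S" unfolding cyclic_def
  proof (intro equalityI subsetI)
    fix x assume x: "x \<in> ?S"
    show "x \<in> \<Union> {D. circuit n I D \<and> D \<subseteq> ?S}"
    proof (cases "x \<in> C")
      case True
      then show ?thesis using assms(2) circuit_subset_mspan[OF assms(2,3)] by blast
    next
      case False
      then have dep: "insert x ?B \<notin> I" using x unfolding mspan_def by blast
      have "insert x ?B \<subseteq> {..<n}" using x BS unfolding mspan_def by auto
      then obtain D where D: "circuit n I D" "D \<subseteq> insert x ?B"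
        using dependent_contains_circuit dep by blast
      have "x \<in> D"
      proof (rule ccontr)
        assume "x \<notin> D"
        then have "D \<in> I" using D(2) matroid_down[OF assms(1) B] by blast
        then show False using D(1) unfolding circuit_def by blast
      qed
      then show ?thesis using D x BS by blast
    qed
  qed blast
  ultimately show ?thesis unfolding cyclic_flat_def by blast
qed

lemma schubert_mspan_chain:
  assumes "matroid n I" "schubert n I" "circuit n I C" "c \<in> C" "circuit n I D" "d \<in> D"
  shows "mspan n I (C - {c}) \<subseteq> mspan n I (D - {d}) \<or> mspan n I (D - {d}) \<subseteq> mspan n I (C - {c})"
  using assms cyclic_flat_mspan unfolding schubert_def by blast

section \<open>Even edge sets of a graph\<close>

text \<open>The cycle space over GF(2); a loop is incident with no vertex.\<close>
definition even_edges :: "(nat \<Rightarrow> nat \<times> nat) \<Rightarrow> nat set \<Rightarrow> bool" where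
  "even_edges ends B \<longleftrightarrow> finite B \<and>
     (\<forall>v. even (card {e \<in> B. (fst (ends e) = v) \<noteq> (snd (ends e) = v)}))"

lemma even_card_sym_diff:
  assumes "finite X" "finite Y"
  shows "even (card ((X - Y) \<union> (Y - X))) \<longleftrightarrow> (even (card X) \<longleftrightarrow> even (card Y))"
proof -
  have "card ((X - Y) \<union> (Y - X)) = card (X - Y) + card (Y - X)"
    using assms by (intro card_Un_disjoint) auto
  moreover have "card X = card (X - Y) + card (X \<inter> Y)" "card Y = card (Y - X) + card (X \<inter> Y)"
    using assms by (metis Int_Diff_disjoint Int_Diff_Un add.commute card_Un_disjoint finite_Diff finite_Int Int_commute)+
  ultimately show ?thesis by auto
qed

lemma even_edges_sym_diff:
  assumes "even_edges ends X" "even_edges ends Y"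
  shows "even_edges ends ((X - Y) \<union> (Y - X))"
proof -
  let ?S = "\<lambda>X v. {e \<in> X. (fst (ends e) = v) \<noteq> (snd (ends e) = v)}"
  have "?S ((X - Y) \<union> (Y - X)) v = (?S X v - ?S Y v) \<union> (?S Y v - ?S X v)" for v by blast
  then show ?thesis using assms unfolding even_edges_def by (simp add: even_card_sym_diff)
qed

lemma has_cycle_imp_even_edges:
  assumes "has_cycle ends A"
  obtains B where "B \<subseteq> A" "B \<noteq> {}" "even_edges ends B"
proof -
  obtain es vs where len: "length es = length vs" "length es \<ge> 1" and dist: "distinct es"
    and sub: "set es \<subseteq> A"
    and ends: "\<And>i. i < length es \<Longrightarrow> {fst (ends (es ! i)), snd (ends (es ! i))}
                        = {vs ! i, vs ! ((i + 1) mod length es)}"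
    using assms unfolding has_cycle_def by blast
  let ?m = "length es"
  let ?inc = "\<lambda>e v. (fst (ends e) = v) \<noteq> (snd (ends e) = v)"
  have "even (card {e \<in> set es. ?inc e v})" for v
  proof -
    let ?f = "\<lambda>i. of_bool (vs ! i = v) :: nat"
    have "{e \<in> set es. ?inc e v} = (\<lambda>i. es ! i) ` {i \<in> {..<?m}. ?inc (es ! i) v}"
      by (force simp: in_set_conv_nth image_iff)
    moreover have "inj_on (\<lambda>i. es ! i) {i \<in> {..<?m}. ?inc (es ! i) v}"
      using dist by (auto simp: inj_on_def nth_eq_iff_index_eq)
    ultimately have "card {e \<in> set es. ?inc e v} = card {i \<in> {..<?m}. ?inc (es ! i) v}"
      by (simp only: card_image)
    also have "\<dots> = (\<Sum>i<?m. of_bool (?inc (es ! i) v))"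
      by (simp add: Int_def of_bool_def sum.If_cases)
    finally have c: "card {e \<in> set es. ?inc e v} = (\<Sum>i<?m. of_bool (?inc (es ! i) v))" .
    \<comment> \<open>Modulo 2, an edge is incident with \<open>v\<close> as often as
      \<open>v\<close> occurs among its two ends. The cyclic shift makes first and second ends
      contribute equally, so the total is even.\<close>
    have "even (\<Sum>i<?m. of_bool (?inc (es ! i) v) + (?f i + ?f ((i + 1) mod ?m)))"
    proof (rule dvd_sum)
      fix i assume "i \<in> {..<?m}"
      then have "(fst (ends (es ! i)) = vs ! i \<and> snd (ends (es ! i)) = vs ! ((i + 1) mod ?m)) \<or>
         (fst (ends (es ! i)) = vs ! ((i + 1) mod ?m) \<and> snd (ends (es ! i)) = vs ! i)"
        using ends[of i] by (simp add: doubleton_eq_iff)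
      then show "even (of_bool (?inc (es ! i) v) + (?f i + ?f ((i + 1) mod ?m)))"
        by (elim disjE conjE) (simp_all)
    qed
    moreover have "(\<Sum>i<?m. ?f ((i + 1) mod ?m)) = (\<Sum>i<?m. ?f i)"
    proof -
      obtain l where l: "?m = Suc l" using len(2) by (cases ?m) auto
      have "(\<Sum>i<Suc l. ?f ((i + 1) mod Suc l)) = (\<Sum>i<l. ?f (Suc i)) + ?f 0"
        by simp
      also have "\<dots> = (\<Sum>i<Suc l. ?f i)"
        unfolding sum.lessThan_Suc_shift by simp
      finally show ?thesis using l by simp
    qed
    ultimately show ?thesis unfolding c by (simp add: sum.distrib)
  qed
  then have "even_edges ends (set es)" unfolding even_edges_def by simp
  then show ?thesis using that[of "set es"] sub len(2) by (cases es) auto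
qed

text \<open>Close up a longest path.\<close>
lemma min_degree_two_imp_has_cycle:
  assumes fin: "finite B" and ne: "B \<noteq> {}"
    and noloop: "\<And>e. e \<in> B \<Longrightarrow> fst (ends e) \<noteq> snd (ends e)"
    and deg: "\<And>e v. e \<in> B \<Longrightarrow> v \<in> {fst (ends e), snd (ends e)} \<Longrightarrow>
                \<exists>f\<in>B. f \<noteq> e \<and> v \<in> {fst (ends f), snd (ends f)}"
  shows "has_cycle ends B"
proof -
  let ?ep = "\<lambda>e. {fst (ends e), snd (ends e)}"
  define path where "path es vs \<longleftrightarrow> length vs = Suc (length es) \<and> distinct vs \<and> distinct es \<and>
      set es \<subseteq> B \<and> es \<noteq> [] \<and> (\<forall>i<length es. ?ep (es ! i) = {vs ! i, vs ! Suc i})" for es vs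
  obtain e where e: "e \<in> B" using ne by blast
  have "path [e] [fst (ends e), snd (ends e)]"
    unfolding path_def using e noloop by auto
  moreover have "length es \<le> card B" if "path es vs" for es vs
    using that fin unfolding path_def by (metis card_mono distinct_card)
  ultimately obtain es where ex: "\<exists>vs. path es vs"
    and max: "\<And>es' vs'. path es' vs' \<Longrightarrow> length es' \<le> length es"
    using ex_has_greatest_nat[of "\<lambda>es. \<exists>vs. path es vs" "[e]" length "Suc (card B)"]
    by (metis less_Suc_eq_le)
  obtain vs where path: "path es vs" using ex by blast
  have len: "length vs = Suc (length es)" and dv: "distinct vs" and de: "distinct es"
    and sub: "set es \<subseteq> B" and esne: "es \<noteq> []"
    and ends: "\<And>i. i < length es \<Longrightarrow> ?ep (es ! i) = {vs ! i, vs ! Suc i}"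
    using path unfolding path_def by auto
  have "es ! 0 \<in> B" using sub esne by auto
  moreover have "vs ! 0 \<in> ?ep (es ! 0)" using ends[of 0] esne by auto
  \<comment> \<open>A second edge at the start of the path. Its other end \<open>w\<close> must lie
    on the path, which \<open>f\<close> would otherwise prolong.\<close>
  ultimately obtain f where f: "f \<in> B" "f \<noteq> es ! 0" "vs ! 0 \<in> ?ep f" using deg by blast
  obtain w where w: "?ep f = {w, vs ! 0}" "w \<noteq> vs ! 0" using f noloop by force
  have w_in: "w \<in> set vs"
  proof (rule ccontr)
    assume nw: "w \<notin> set vs"
    have "f \<notin> set es"
    proof
      assume "f \<in> set es"
      then obtain i where "i < length es" "es ! i = f" by (auto simp: in_set_conv_nth)
      then have "w \<in> {vs ! i, vs ! Suc i}" using ends w by blast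
      then show False using nw len \<open>i < length es\<close> by auto
    qed
    then have "path (f # es) (w # vs)"
      unfolding path_def using len dv de sub f(1) nw w ends
      by (auto simp: nth_Cons split: nat.split)
    then show False using max by fastforce
  qed
  then obtain j where j: "j < length vs" "vs ! j = w" by (auto simp: in_set_conv_nth)
  then have j0: "0 < j" using w(2) by (cases j) auto
  \<comment> \<open>The path is cut at \<open>w\<close> and closed by \<open>f\<close>. The edge
    \<open>f\<close> is new: since vertices are distinct, \<open>es ! 0\<close> is the only path
    edge at \<open>vs ! 0\<close>.\<close>
  let ?es = "take j es @ [f]" let ?vs = "take (Suc j) vs"
  have jl: "j \<le> length es" using j(1) len by simp
  have "f \<notin> set (take j es)"
  proof
    assume "f \<in> set (take j es)"
    then obtain i where i: "i < j" "es ! i = f" "i < length es"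
      by (auto simp: in_set_conv_nth)
    then have "i \<noteq> 0" using f(2) by (metis)
    have "vs ! 0 \<in> {vs ! i, vs ! Suc i}" using ends[OF i(3)] i(2) f(3) by blast
    then show False using dv i(3) len \<open>i \<noteq> 0\<close> by (auto simp: nth_eq_iff_index_eq)
  qed
  then have d: "distinct ?es" "distinct ?vs" using de dv by auto
  have l: "length ?es = Suc j" "length ?vs = Suc j" using jl len by auto
  have "?ep (?es ! i) = {?vs ! i, ?vs ! ((i + 1) mod length ?es)}" if "i < length ?es" for i
  proof (cases "i = j")
    case True
    then show ?thesis using w j l jl by (simp add: nth_append)
  next
    case False
    then have ij: "i < j" using that l by simp
    then show ?thesis using ends[of i] l jl by (simp add: nth_append)
  qed
  moreover have "set ?es \<subseteq> B" using sub f(1) set_take_subset by force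
  ultimately show ?thesis
    unfolding has_cycle_def using d l by - (rule exI[of _ ?es], rule exI[of _ ?vs], simp)
qed

lemma has_cycle_mono: "has_cycle ends B \<Longrightarrow> B \<subseteq> A \<Longrightarrow> has_cycle ends A"
  unfolding has_cycle_def by (meson subset_trans)

lemma loop_has_cycle:
  assumes "e \<in> A" "fst (ends e) = snd (ends e)"
  shows "has_cycle ends A"
  unfolding has_cycle_def
  by (rule exI[of _ "[e]"], rule exI[of _ "[snd (ends e)]"]) (use assms in simp)

text \<open>A loop is a cycle by itself; without loops, evenness excludes vertices of degree
  one.\<close>

lemma even_edges_imp_has_cycle:
  assumes "even_edges ends B" "B \<noteq> {}"
  shows "has_cycle ends B"
proof (cases "\<exists>e\<in>B. fst (ends e) = snd (ends e)")
  case True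
  then show ?thesis using loop_has_cycle by blast
next
  case False
  show ?thesis
  proof (rule min_degree_two_imp_has_cycle)
    show "finite B" using assms(1) even_edges_def by blast
    fix e v assume e: "e \<in> B" and v: "v \<in> {fst (ends e), snd (ends e)}"
    let ?S = "{e \<in> B. (fst (ends e) = v) \<noteq> (snd (ends e) = v)}"
    have "e \<in> ?S" using e v False by auto
    moreover have "even (card ?S)" using assms(1) even_edges_def by blast
    ultimately have "?S \<noteq> {e}" by force
    then obtain f where "f \<in> ?S" "f \<noteq> e" using \<open>e \<in> ?S\<close> by blast
    then show "\<exists>f\<in>B. f \<noteq> e \<and> v \<in> {fst (ends f), snd (ends f)}" by auto
  qed (use assms False in auto)
qed

text \<open>The interface through which graphs enter the classification: \<open>Z\<close> is the
  cycle space over GF(2), and circuits are combined by symmetric difference instead of following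
  vertices.\<close>

lemma graphic_binary:
  assumes "graphic n I"
  obtains Z where "\<And>X Y. Z X \<Longrightarrow> Z Y \<Longrightarrow> Z ((X - Y) \<union> (Y - X))"
    "\<And>A. A \<subseteq> {..<n} \<Longrightarrow> A \<notin> I \<longleftrightarrow> (\<exists>B\<subseteq>A. B \<noteq> {} \<and> Z B)"
proof -
  obtain ends where ends: "\<And>A. A \<subseteq> {..<n} \<Longrightarrow> A \<in> I \<longleftrightarrow> \<not> has_cycle ends A"
    using assms unfolding graphic_def by blast
  have "A \<notin> I \<longleftrightarrow> (\<exists>B\<subseteq>A. B \<noteq> {} \<and> even_edges ends B)" if "A \<subseteq> {..<n}" for A
    using ends[OF that] has_cycle_imp_even_edges even_edges_imp_has_cycle has_cycle_mono by metis
  then show ?thesis using that[of "even_edges ends"] even_edges_sym_diff by blast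
qed

section \<open>Circuits with a parallel class\<close>

text \<open>The cycle matroid of a graph consisting of a circuit \<open>R \<union> {p}\<close> whose edge \<open>p\<close> is replaced by a
  class \<open>P\<close> of parallel edges, together with loops \<open>L\<close>; the remaining elements are coloops.\<close>
definition theta :: "nat \<Rightarrow> nat set \<Rightarrow> nat set \<Rightarrow> nat set \<Rightarrow> nat set set" where
  "theta n R P L = {A. A \<subseteq> {..<n} \<and> A \<inter> L = {} \<and> card (A \<inter> P) \<le> 1 \<and> \<not> (R \<subseteq> A \<and> A \<inter> P \<noteq> {})}"

definition theta_parts :: "nat \<Rightarrow> nat set \<Rightarrow> nat set \<Rightarrow> nat set \<Rightarrow> bool" where
  "theta_parts n R P L \<longleftrightarrow> R \<subseteq> {..<n} \<and> P \<subseteq> {..<n} \<and> L \<subseteq> {..<n} \<and>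
     R \<inter> P = {} \<and> R \<inter> L = {} \<and> P \<inter> L = {}"

lemma card_Int_le_1_insert:
  assumes "finite A" "A \<inter> P = {}"
  shows "card (insert p A \<inter> P) \<le> 1"
proof -
  have "insert p A \<inter> P \<subseteq> {p}" using assms(2) by blast
  then show ?thesis using card_mono[of "{p}"] by fastforce
qed

lemma card_gt_1_two_elements:
  assumes "1 < card X"
  obtains p q where "p \<in> X" "q \<in> X" "p \<noteq> q"
proof -
  have "finite X" using assms card.infinite[of X] by fastforce
  then show ?thesis using assms that card_le_Suc0_iff_eq[of X] by fastforce
qed

lemma matroid_theta:
  assumes "theta_parts n R P L"
  shows "matroid n (theta n R P L)"
  unfolding matroid_def
proof (intro conjI ballI allI impI)
  show "{} \<in> theta n R P L" by (simp add: theta_def)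
next
  fix A assume "A \<in> theta n R P L" then show "A \<subseteq> {..<n}" by (simp add: theta_def)
next
  fix A B assume A: "A \<in> theta n R P L" "B \<subseteq> A"
  then have "finite A" using finite_subset[of A "{..<n}"] by (auto simp: theta_def)
  then have "card (B \<inter> P) \<le> card (A \<inter> P)" using A(2) by (intro card_mono) auto
  then show "B \<in> theta n R P L" using A by (auto simp: theta_def)
next
  fix A B assume A: "A \<in> theta n R P L" and B: "B \<in> theta n R P L" and lt: "card A < card B"
  \<comment> \<open>Coloops and loops together. Independent sets avoid \<open>L\<close>, so any
    element of \<open>B\<close> in this part can be added to \<open>A\<close>; otherwise the excess
    of \<open>B\<close> lies in \<open>R\<close> and \<open>P\<close>.\<close>
  let ?C = "{..<n} - R - P"
  have fin: "finite A" "finite B" "finite R" "finite P"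
    using A B assms finite_subset[of _ "{..<n}"] by (auto simp: theta_def theta_parts_def)
  have split: "card X = card (X \<inter> ?C) + card (X \<inter> R) + card (X \<inter> P)"
    if "X \<subseteq> {..<n}" for X
  proof -
    have f: "finite X" using that finite_subset by blast
    have "X = (X \<inter> ?C) \<union> ((X \<inter> R) \<union> (X \<inter> P))" using that by auto
    then have "card X = card ((X \<inter> ?C) \<union> ((X \<inter> R) \<union> (X \<inter> P)))" by simp
    also have "\<dots> = card (X \<inter> ?C) + card ((X \<inter> R) \<union> (X \<inter> P))"
      using f by (intro card_Un_disjoint) auto
    also have "card ((X \<inter> R) \<union> (X \<inter> P)) = card (X \<inter> R) + card (X \<inter> P)"
      using f assms unfolding theta_parts_def by (intro card_Un_disjoint) auto
    finally show ?thesis by simp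
  qed
  have subs: "A \<subseteq> {..<n}" "B \<subseteq> {..<n}" using A B by (auto simp: theta_def)
  note sA = split[OF subs(1)] and sB = split[OF subs(2)]
  have PA: "card (A \<inter> P) \<le> 1" "card (B \<inter> P) \<le> 1" using A B by (auto simp: theta_def)
  \<comment> \<open>An element of \<open>P\<close> excludes some element of \<open>R\<close>, so an
    independent set meeting \<open>P\<close> has at most \<open>card R\<close> elements in
    \<open>R \<union> P\<close>.\<close>
  have bound: "card (B \<inter> R) + card (B \<inter> P) \<le> card R" if "card (B \<inter> P) \<noteq> 0"
  proof -
    have "B \<inter> P \<noteq> {}" using that by auto
    then have "B \<inter> R \<subset> R" using B by (auto simp: theta_def)
    then have "card (B \<inter> R) < card R" using fin by (intro psubset_card_mono)
    then show ?thesis using PA by simp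
  qed
  show "\<exists>e\<in>B - A. insert e A \<in> theta n R P L"
  proof (cases "B \<inter> ?C \<subseteq> A")
    case False
    then obtain e where e: "e \<in> B" "e \<in> ?C" "e \<notin> A" by blast
    then have "insert e A \<inter> P = A \<inter> P" "R \<subseteq> insert e A \<longleftrightarrow> R \<subseteq> A" "e \<notin> L"
      using B by (auto simp: theta_def)
    then have "insert e A \<in> theta n R P L" using A e by (auto simp: theta_def)
    then show ?thesis using e by blast
  next
    case True
    then have "card (B \<inter> ?C) \<le> card (A \<inter> ?C)" using fin by (intro card_mono) auto
    then have gt: "card (A \<inter> R) + card (A \<inter> P) < card (B \<inter> R) + card (B \<inter> P)"
      using sA sB lt by linarith
    show ?thesis
    proof (cases "A \<inter> P = {} \<and> B \<inter> P \<noteq> {}")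
      case True
      then obtain p where p: "p \<in> B" "p \<in> P" "p \<notin> A" by blast
      have "card (B \<inter> P) \<noteq> 0" using True fin by simp
      then have "card (A \<inter> R) < card R" using bound gt by linarith
      then have "\<not> R \<subseteq> A" by (auto simp: Int_absorb1)
      then have "\<not> R \<subseteq> insert p A" using p assms unfolding theta_parts_def by blast
      then have "insert p A \<in> theta n R P L"
        using A B p True card_Int_le_1_insert[OF fin(1)] by (auto simp: theta_def)
      then show ?thesis using p by blast
    next
      case False
      have gtR: "card (A \<inter> R) < card (B \<inter> R)"
      proof (cases "A \<inter> P = {}")
        case True
        then show ?thesis using False gt by simp
      next
        case False
        then have "card (A \<inter> P) \<noteq> 0" using fin by simp
        then show ?thesis using gt PA by linarith
      qed
      then have "\<not> B \<inter> R \<subseteq> A \<inter> R" using card_mono[of "A \<inter> R" "B \<inter> R"] fin by auto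
      then obtain e where e: "e \<in> B" "e \<in> R" "e \<notin> A" by blast
      have P: "insert e A \<inter> P = A \<inter> P" using e assms unfolding theta_parts_def by blast
      \<comment> \<open>Completing \<open>R\<close> here would mean that \<open>A\<close> already
        has \<open>card R\<close> elements in \<open>R \<union> P\<close>, and \<open>B\<close>
        cannot have more.\<close>
      have "\<not> R \<subseteq> insert e A" if "A \<inter> P \<noteq> {}"
      proof
        assume "R \<subseteq> insert e A"
        then have "R = insert e (A \<inter> R)" using e by blast
        then have "card R = Suc (card (A \<inter> R))" using e fin
          by (metis IntD1 card_insert_disjoint finite_Int)
        moreover have "card (A \<inter> P) \<noteq> 0" using that fin by simp
        moreover have "card (B \<inter> R) \<le> card R" using fin by (intro card_mono) auto
        ultimately show False using gt bound by (cases "card (B \<inter> P) = 0") linarith+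
      qed
      then have "insert e A \<in> theta n R P L"
        using A B e P by (auto simp: theta_def)
      then show ?thesis using e by blast
    qed
  qed
qed

text \<open>\<open>A - P - L\<close> is independent, loops add nothing, and the class
  \<open>P\<close> as a whole adds one unless \<open>R\<close> already spans it.\<close>

lemma mrank_theta:
  assumes parts: "theta_parts n R P L" and A: "A \<subseteq> {..<n}"
  shows "mrank (theta n R P L) A =
    card (A - P - L) + (if A \<inter> P \<noteq> {} \<and> \<not> R \<subseteq> A then 1 else 0)" (is "_ = ?r")
proof (rule antisym)
  note M = matroid_theta[OF parts]
  have fin: "finite A" using A finite_subset by blast
  obtain B where B: "B \<in> theta n R P L" "B \<subseteq> A" "card B = mrank (theta n R P L) A"
    using mrank_attained M by blast
  have finB: "finite B" using B(2) fin finite_subset by blast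
  have "B = (B - P - L) \<union> (B \<inter> P)" "(B - P - L) \<inter> (B \<inter> P) = {}"
    using B(1) by (auto simp: theta_def)
  then have cB: "card B = card (B - P - L) + card (B \<inter> P)"
    using card_Un_disjoint[of "B - P - L" "B \<inter> P"] finB by simp
  have P1: "card (B \<inter> P) \<le> 1" using B(1) by (simp add: theta_def)
  have le: "card (B - P - L) \<le> card (A - P - L)" using fin B(2) by (intro card_mono) auto
  have "card B \<le> ?r"
  proof (cases "B \<inter> P \<noteq> {} \<and> R \<subseteq> A")
    case True
    then have "\<not> R \<subseteq> B" using B(1) by (simp add: theta_def)
    then have "B - P - L \<subset> A - P - L"
      using True B(2) parts unfolding theta_parts_def by blast
    then have "card (B - P - L) < card (A - P - L)" using fin by (intro psubset_card_mono) auto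
    then show ?thesis using cB P1 by simp
  next
    case False
    then have "B \<inter> P = {} \<or> A \<inter> P \<noteq> {} \<and> \<not> R \<subseteq> A" using B(2) by blast
    then show ?thesis using cB P1 le by auto
  qed
  then show "mrank (theta n R P L) A \<le> ?r" using B(3) by simp
  show "?r \<le> mrank (theta n R P L) A"
  proof (cases "A \<inter> P \<noteq> {} \<and> \<not> R \<subseteq> A")
    case True
    then obtain p where p: "p \<in> A" "p \<in> P" by blast
    let ?B = "insert p (A - P - L)"
    have "card (?B \<inter> P) \<le> 1" using fin by (intro card_Int_le_1_insert) auto
    moreover have "p \<notin> L" "p \<notin> R" using p parts unfolding theta_parts_def by auto
    ultimately have "?B \<in> theta n R P L"
      using p True A unfolding theta_def by auto
    then have "card ?B \<le> mrank (theta n R P L) A" using p by (intro card_le_mrank[OF M]) auto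
    then show ?thesis using p fin True by simp
  next
    case False
    have e: "(A - P - L) \<inter> P = {}" by blast
    have "A - P - L \<in> theta n R P L" using A e by (auto simp: theta_def)
    then have "card (A - P - L) \<le> mrank (theta n R P L) A" by (intro card_le_mrank[OF M]) auto
    then show ?thesis using False by auto
  qed
qed

lemma matroid_rank_theta:
  assumes "theta_parts n R P L"
  shows "matroid_rank n (theta n R P L) = n - card P - card L"
proof -
  have s: "P \<subseteq> {..<n}" "L \<subseteq> {..<n} - P" "R \<subseteq> {..<n}"
    using assms unfolding theta_parts_def by auto
  then have f: "finite P" "finite L" using finite_subset by blast+
  have "card ({..<n} - P - L) = n - card P - card L"
    using s f by (simp add: card_Diff_subset)
  then show ?thesis
    unfolding matroid_rank_def using mrank_theta[OF assms subset_refl] s by simp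
qed

text \<open>Each of the three ways to violate the definition of \<open>theta\<close> exhibits a
  dependent subset of \<open>C\<close>, which by minimality is all of \<open>C\<close>.\<close>

lemma circuit_theta_cases:
  assumes parts: "theta_parts n R P L" and C: "circuit n (theta n R P L) C"
  obtains (loop) l where "l \<in> L" "C = {l}"
  | (parallel) p q where "p \<in> P" "q \<in> P" "C = {p, q}"
  | (cycle) p where "p \<in> P" "C = insert p R"
proof -
  note M = matroid_theta[OF parts]
  have sub: "C \<subseteq> {..<n}" and nin: "C \<notin> theta n R P L" using C unfolding circuit_def by auto
  have eq: "X = C" if "X \<subseteq> C" "X \<notin> theta n R P L" for X
    using circuit_proper_subset_indep[OF M C] that by blast
  consider "C \<inter> L \<noteq> {}" | "\<not> card (C \<inter> P) \<le> 1" | "R \<subseteq> C" "C \<inter> P \<noteq> {}"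
    using nin sub unfolding theta_def by blast
  then show ?thesis
  proof cases
    case 1
    then obtain l where l: "l \<in> C" "l \<in> L" by blast
    have "{l} = C" by (rule eq) (use l in \<open>auto simp: theta_def\<close>)
    then show ?thesis using loop l by blast
  next
    case 2
    then obtain p q where pq: "p \<in> C \<inter> P" "q \<in> C \<inter> P" "p \<noteq> q"
      using card_gt_1_two_elements by (metis linorder_not_less)
    have "{p, q} \<inter> P = {p, q}" using pq by blast
    then have "{p, q} \<notin> theta n R P L" using pq by (simp add: theta_def)
    then have "{p, q} = C" by (intro eq) (use pq in auto)
    then show ?thesis using parallel pq by blast
  next
    case 3
    then obtain p where p: "p \<in> C" "p \<in> P" by blast
    have "insert p R = C" by (rule eq) (use p 3 in \<open>auto simp: theta_def\<close>)
    then show ?thesis using cycle p by blast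
  qed
qed

text \<open>A cyclic flat contains all loops, contains \<open>P\<close> once it meets
  \<open>P\<close>, and contains both \<open>R\<close> and \<open>P\<close> once it meets
  \<open>R\<close>. So only \<open>L\<close>, \<open>L \<union> P\<close> and
  \<open>L \<union> P \<union> R\<close> can occur, and these are nested.\<close>

lemma schubert_theta:
  assumes parts: "theta_parts n R P L"
  shows "schubert n (theta n R P L)"
proof -
  let ?I = "theta n R P L"
  note M = matroid_theta[OF parts]
  have disj: "R \<inter> P = {}" "R \<inter> L = {}" "P \<inter> L = {}" "P \<subseteq> {..<n}" "L \<subseteq> {..<n}" "R \<subseteq> {..<n}"
    using parts unfolding theta_parts_def by auto
  have "F = L \<or> F = L \<union> P \<or> F = L \<union> P \<union> R" if "cyclic_flat n ?I F" for F
  proof -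
    have flat: "flat n ?I F" and cyc: "\<And>x. x \<in> F \<Longrightarrow> \<exists>C. circuit n ?I C \<and> x \<in> C \<and> C \<subseteq> F"
      using that unfolding cyclic_flat_def cyclic_def by auto
    have dep: "e \<in> F" if D: "D \<notin> ?I" "D \<subseteq> {..<n}" "D - {e} \<subseteq> F" "D - {e} \<in> ?I" for D e
    proof -
      obtain C where C: "circuit n ?I C" "C \<subseteq> D"
        using dependent_contains_circuit[OF D(2,1)] by blast
      have "e \<in> C"
      proof (rule ccontr)
        assume "e \<notin> C"
        then have "C \<in> ?I" using C(2) matroid_down[OF M D(4)] by blast
        then show False using C(1) unfolding circuit_def by blast
      qed
      then show ?thesis using flat_contains_circuit_end[OF M flat C(1)] C(2) D(3) by blast
    qed
    have LF: "L \<subseteq> F"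
    proof
      fix l assume l: "l \<in> L"
      show "l \<in> F" by (rule dep[of "{l}"]) (use l disj in \<open>auto simp: theta_def\<close>)
    qed
    have FE: "F \<subseteq> L \<union> P \<union> R"
    proof
      fix x assume "x \<in> F"
      then obtain C where C: "circuit n ?I C" "x \<in> C" using cyc by blast
      then show "x \<in> L \<union> P \<union> R" by (cases rule: circuit_theta_cases[OF parts C(1)]) auto
    qed
    have PF: "P \<subseteq> F" if p: "p \<in> P" "p \<in> F" for p
    proof
      fix q assume q: "q \<in> P"
      show "q \<in> F"
      \<comment> \<open>If \<open>R\<close> is empty, the elements of \<open>P\<close> are loops,
        and \<open>q\<close> lies in \<open>F\<close> for that reason.\<close>
      proof (cases "{p} \<in> ?I \<and> p \<noteq> q")
        case True
        have i: "{p, q} \<inter> P = {p, q}" using p q by blast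
        show ?thesis
          by (rule dep[of "{p, q}"]) (use True p q disj i in \<open>auto simp: theta_def insert_Diff_if\<close>)
      next
        case False
        then have "R \<subseteq> {p} \<or> p = q" using p disj by (auto simp: theta_def)
        then have "R = {} \<or> p = q" using p disj by auto
        then show ?thesis
        proof
          assume "R = {}"
          then show ?thesis using q disj by (intro dep[of "{q}"]) (auto simp: theta_def)
        qed (use p in simp)
      qed
    qed
    \<comment> \<open>Circuits through an element of \<open>R\<close> have the form
      \<open>insert p R\<close>, and cyclicity places one of them inside \<open>F\<close>.\<close>
    have RF: "R \<subseteq> F \<and> P \<subseteq> F" if x: "x \<in> R" "x \<in> F" for x
    proof -
      obtain C where C: "circuit n ?I C" "x \<in> C" "C \<subseteq> F" using cyc x by blast
      obtain p where p: "p \<in> P" "C = insert p R"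
        using C(2) x(1) disj by (cases rule: circuit_theta_cases[OF parts C(1)]) auto
      then have "p \<in> F" "R \<subseteq> F" using C(3) by auto
      then show ?thesis using PF[OF p(1)] by simp
    qed
    have dP: "F \<inter> P = {} \<or> P \<subseteq> F" using PF by auto
    have dR: "F \<inter> R = {} \<or> R \<subseteq> F \<and> P \<subseteq> F" using RF by auto
    show ?thesis using dP dR LF FE by (elim disjE) auto
  qed
  then show ?thesis unfolding schubert_def by blast
qed

text \<open>The edges of \<open>R\<close> and the coloops form a path; each edge of \<open>P\<close> joins the ends of the
  initial segment \<open>R\<close>.\<close>
lemma graphic_theta:
  assumes r: "r \<le> k"
  shows "graphic n (theta n {..<r} {k..<k + m} {k + m..<n})"
proof -
  define ends :: "nat \<Rightarrow> nat \<times> nat" where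
    "ends i = (if i < k then (i, Suc i) else if i < k + m then (0, r) else (0, 0))" for i
  let ?I = "theta n {..<r} {k..<k + m} {k + m..<n}"
  have "A \<in> ?I \<longleftrightarrow> \<not> has_cycle ends A" if A: "A \<subseteq> {..<n}" for A
  proof
    assume AI: "A \<in> ?I"
    show "\<not> has_cycle ends A"
    proof
      assume "has_cycle ends A"
      then obtain B where B: "B \<subseteq> A" "B \<noteq> {}" "even_edges ends B"
        by (rule has_cycle_imp_even_edges)
      let ?S = "\<lambda>v. {e \<in> B. (fst (ends e) = v) \<noteq> (snd (ends e) = v)}"
      have even: "even (card (?S v))" for v using B(3) unfolding even_edges_def by blast
      have fin: "finite B" using B(3) unfolding even_edges_def by blast
      have Bkm: "B \<subseteq> {..<k + m}" using AI A B(1) unfolding theta_def by fastforce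
      \<comment> \<open>At a vertex where only \<open>e\<close> and \<open>f\<close> can be
        incident, even degree makes \<open>e\<close> force \<open>f\<close>.\<close>
      have other: "f \<in> B" if S: "?S v \<subseteq> {e, f}" "e \<in> ?S v" for v e f
      proof -
        have "?S v \<noteq> {e}" using even[of v] by force
        then obtain g where "g \<in> ?S v" "g \<noteq> e" using S(2) by blast
        moreover have "g = f" using calculation S(1) by blast
        ultimately show ?thesis by blast
      qed
      show False
      proof (cases "B \<inter> {k..<k + m} = {}")
        case True
        then have Bk: "B \<subseteq> {..<k}" using Bkm by fastforce
        \<comment> \<open>Only path edges are left here; the far end of the last one has degree
          one.\<close>
        define i where "i = Max B"
        have i: "i \<in> B" "\<And>e. e \<in> B \<Longrightarrow> e \<le> i" using fin B(2) unfolding i_def by auto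
        have "Suc i \<notin> B" using i(2)[of "Suc i"] by auto
        then have "?S (Suc i) = {i}"
          using i Bk by (auto simp: ends_def subset_iff)
        then show False using even[of "Suc i"] by simp
      next
        case False
        then obtain p where p: "p \<in> B" "k \<le> p" "p < k + m" by auto
        have uniq: "q = p" if "q \<in> B" "k \<le> q" "q < k + m" for q
        proof -
          have "card (A \<inter> {k..<k + m}) \<le> Suc 0" using AI by (simp add: theta_def)
          then have "\<forall>a\<in>A \<inter> {k..<k + m}. \<forall>b\<in>A \<inter> {k..<k + m}. a = b"
            by (subst (asm) card_le_Suc0_iff_eq) auto
          moreover have "q \<in> A \<inter> {k..<k + m}" "p \<in> A \<inter> {k..<k + m}" using that p B(1) by auto
          ultimately show ?thesis by blast
        qed
        have nR: "\<not> {..<r} \<subseteq> A" using AI p B(1) by (auto simp: theta_def)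
        then have r0: "0 < r" by (cases r) auto
        \<comment> \<open>The edge \<open>p\<close> forces edge 0 at vertex 0, and each path edge
          then forces the next one. Thus \<open>B\<close> would contain all of
          \<open>{..<r}\<close>, which \<open>nR\<close> forbids.\<close>
        have "i < r \<Longrightarrow> i \<in> B" for i
        proof (induction i)
          case 0
          have "?S 0 \<subseteq> {p, 0}"
            using Bkm uniq by (auto simp: ends_def subset_iff split: if_splits)
          moreover have "p \<in> ?S 0" using p r0 by (auto simp: ends_def)
          ultimately show ?case by (rule other)
        next
          case (Suc i)
          have "?S (Suc i) \<subseteq> {i, Suc i}"
          proof
            fix e assume "e \<in> ?S (Suc i)"
            then have "fst (ends e) = Suc i \<or> snd (ends e) = Suc i" by blast
            then show "e \<in> {i, Suc i}"
              using Suc.prems unfolding ends_def by (cases "e < k"; cases "e < k + m") auto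
          qed
          moreover have "i \<in> ?S (Suc i)" using Suc r by (auto simp: ends_def)
          ultimately show ?case by (rule other)
        qed
        then show False using nR B(1) by blast
      qed
    qed
  next
    assume nc: "\<not> has_cycle ends A"
    show "A \<in> ?I"
    proof (rule ccontr)
      assume "A \<notin> ?I"
      then consider "A \<inter> {k + m..<n} \<noteq> {}" | "\<not> card (A \<inter> {k..<k + m}) \<le> 1"
        | "{..<r} \<subseteq> A" "A \<inter> {k..<k + m} \<noteq> {}"
        using A unfolding theta_def by blast
      then show False
      proof cases
        case 1
        then obtain l where "l \<in> A" "k + m \<le> l" by auto
        then have "has_cycle ends A" by (intro loop_has_cycle[of l]) (auto simp: ends_def)
        then show False using nc by blast
      next
        case 2
        then obtain p q where pq: "p \<in> A \<inter> {k..<k + m}" "q \<in> A \<inter> {k..<k + m}" "p \<noteq> q"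
          using card_gt_1_two_elements by (metis linorder_not_less)
        have "has_cycle ends A"
        proof (cases "r = 0")
          case True
          then show ?thesis using pq by (intro loop_has_cycle[of p]) (auto simp: ends_def)
        next
          case False
          have "\<forall>i<2. {fst (ends ([p, q] ! i)), snd (ends ([p, q] ! i))} =
                   {[0, r] ! i, [0, r] ! ((i + 1) mod 2)}"
            using pq by (auto simp: ends_def less_2_cases_iff)
          then show ?thesis unfolding has_cycle_def
            using pq False by - (rule exI[of _ "[p, q]"], rule exI[of _ "[0, r]"], auto simp: numeral_2_eq_2)
        qed
        then show False using nc by blast
      next
        case 3
        then obtain p where p: "p \<in> A" "k \<le> p" "p < k + m" by auto
        let ?es = "[0..<r] @ [p]" let ?vs = "[0..<Suc r]"
        have "{fst (ends (?es ! i)), snd (ends (?es ! i))} = {?vs ! i, ?vs ! ((i + 1) mod length ?es)}"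
          if "i < length ?es" for i
        proof (cases "i = r")
          case True
          then show ?thesis using p by (auto simp: ends_def nth_append)
        next
          case False
          then have "i < r" using that by simp
          then show ?thesis using r by (auto simp: ends_def nth_append simp del: upt_Suc)
        qed
        moreover have "distinct ?es" using p r by auto
        ultimately have "has_cycle ends A" unfolding has_cycle_def
          using p 3 by - (rule exI[of _ ?es], rule exI[of _ ?vs], auto)
        then show False using nc by blast
      qed
    qed
  qed
  then show ?thesis unfolding graphic_def by blast
qed

section \<open>Classification of graphic Schubert matroids\<close>

text \<open>A circuit \<open>C\<close> of maximum size supplies \<open>R\<close> and one element of
  \<open>P\<close>; the rest of \<open>P\<close> are the other non-loops in its closure. The last
  conclusion is a normalisation: if only \<open>P\<close> were empty, \<open>R\<close> would consist
  of coloops, and if only \<open>R\<close> were empty, \<open>P\<close> would consist of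
  loops.\<close>

lemma graphic_schubert_imp_theta:
  assumes M: "matroid n I" and graphic: "graphic n I" and schubert: "schubert n I"
  obtains R P L where "theta_parts n R P L" "I = theta n R P L" "R = {} \<longleftrightarrow> P = {}"
proof -
  obtain Z where Zdiff: "\<And>X Y. Z X \<Longrightarrow> Z Y \<Longrightarrow> Z ((X - Y) \<union> (Y - X))"
    and dep: "\<And>A. A \<subseteq> {..<n} \<Longrightarrow> A \<notin> I \<longleftrightarrow> (\<exists>B\<subseteq>A. B \<noteq> {} \<and> Z B)"
    using graphic_binary[OF graphic] by blast
  have Z_dep: "X \<notin> I" if "Z X" "X \<noteq> {}" "X \<subseteq> {..<n}" for X
    using dep[OF that(3)] that by blast
  have sub: "C \<subseteq> {..<n}" and nin: "C \<notin> I" and ne: "C \<noteq> {}" if "circuit n I C" for C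
    using that matroid_empty[OF M] unfolding circuit_def by auto
  have circuit_eq: "X = C" if "circuit n I C" "X \<subseteq> C" "X \<notin> I" for X C
    using circuit_proper_subset_indep[OF M that(1)] that(2,3) by blast
  have circuit_Z: "Z C" if C: "circuit n I C" for C
  proof -
    obtain B where B: "B \<subseteq> C" "B \<noteq> {}" "Z B" using dep[OF sub[OF C]] nin[OF C] by blast
    have "B \<subseteq> {..<n}" using B(1) sub[OF C] by blast
    then have "B = C" using circuit_eq[OF C B(1)] Z_dep[OF B(3,2)] by blast
    then show ?thesis using B by blast
  qed
  define L where "L = {e. e < n \<and> {e} \<notin> I}"
  have L_dep: "A \<inter> L = {}" if "A \<in> I" for A
  proof (rule ccontr)
    assume "A \<inter> L \<noteq> {}"
    then obtain l where "l \<in> A" "{l} \<notin> I" unfolding L_def by blast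
    then show False using matroid_down[OF M that, of "{l}"] by blast
  qed
  show ?thesis
  proof (cases "\<exists>C. circuit n I C \<and> 2 \<le> card C")
    case False
    have "A \<in> I \<longleftrightarrow> A \<in> theta n {} {} L" for A
    proof
      assume "A \<in> I"
      then show "A \<in> theta n {} {} L"
        using L_dep matroid_subset[OF M] unfolding theta_def by auto
    next
      assume A: "A \<in> theta n {} {} L"
      show "A \<in> I"
      proof (rule ccontr)
        assume "A \<notin> I"
        then obtain C where C: "circuit n I C" "C \<subseteq> A"
          using dependent_contains_circuit[of A n I] A unfolding theta_def by blast
        have "card C \<noteq> 0" using ne[OF C(1)] circuit_finite[OF C(1)] by simp
        then have "card C = 1" using False C(1) by fastforce
        then obtain l where "C = {l}" using card_1_singletonE by blast
        then have "l \<in> A \<inter> L" using C sub[OF C(1)] nin[OF C(1)] unfolding L_def by auto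
        then show False using A unfolding theta_def by blast
      qed
    qed
    then have "I = theta n {} {} L" by blast
    moreover have "theta_parts n {} {} L" unfolding theta_parts_def L_def by auto
    ultimately show ?thesis using that by blast
  next
    case True
    have bounded: "\<forall>C. circuit n I C \<and> 2 \<le> card C \<longrightarrow> card C < Suc n"
      using sub card_mono[of "{..<n}"] by (fastforce simp: less_Suc_eq_le)
    obtain C where C: "circuit n I C" "2 \<le> card C"
      and max': "\<forall>D. circuit n I D \<and> 2 \<le> card D \<longrightarrow> card D \<le> card C"
      using True ex_has_greatest_nat[OF _ bounded] by blast
    have max: "card D \<le> card C" if "circuit n I D" for D
      using max' that C(2) by (cases "2 \<le> card D") auto
    note finC = circuit_finite[OF C(1)] and Cn = sub[OF C(1)] and CZ = circuit_Z[OF C(1)]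
    have C_proper: "X \<in> I" if "X \<subset> C" for X
      using circuit_proper_subset_indep[OF M C(1) that] .
    have C_single: "{c} \<in> I" if "c \<in> C" for c
    proof (rule C_proper)
      have "{c} \<noteq> C" using C(2) by auto
      then show "{c} \<subset> C" using that by blast
    qed
    obtain c where c: "c \<in> C" using ne[OF C(1)] by blast
    define S where "S = mspan n I (C - {c})"
    have Cc: "C - {c} \<in> I" using C(1) c unfolding circuit_def by blast
    have CS: "C \<subseteq> S" unfolding S_def by (rule circuit_subset_mspan[OF C(1) c])
    have circ_S: "D \<subseteq> S" if D: "circuit n I D" for D
    proof -
      obtain d where d: "d \<in> D" using ne[OF D] by blast
      let ?T = "mspan n I (D - {d})"
      have DT: "D \<subseteq> ?T" by (rule circuit_subset_mspan[OF D d])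
      have Dd: "D - {d} \<in> I" using D d unfolding circuit_def by blast
      show ?thesis
      proof (rule ccontr)
        assume "\<not> D \<subseteq> S"
        then obtain x where x: "x \<in> D" "x \<notin> S" by blast
        \<comment> \<open>The chain condition leaves the larger span to \<open>D\<close>. It then
          holds an independent set of size \<open>card C\<close>, although its rank is
          \<open>card D - 1\<close>, against the maximality of \<open>C\<close>.\<close>
        then have ST: "S \<subseteq> ?T"
          using schubert_mspan_chain[OF M schubert C(1) c D d] DT unfolding S_def by blast
        have ins: "insert x (C - {c}) \<in> I" "x \<notin> C - {c}"
          using x sub[OF D] unfolding S_def mspan_def by auto
        have "insert x (C - {c}) \<subseteq> ?T" using x DT CS ST by blast
        then have "card (insert x (C - {c})) \<le> card (D - {d})"
          using indep_in_mspan_card[OF M Dd ins(1)] by blast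
        moreover have "card (insert x (C - {c})) = card C"
          using ins(2) finC card_Suc_Diff1[OF finC c] by simp
        moreover have "card (D - {d}) < card D"
          using d circuit_finite[OF D] by (intro card_Diff1_less)
        ultimately show False using max[OF D] by simp
      qed
    qed
    \<comment> \<open>\<open>D\<close> and \<open>D'\<close> play the two cycles into which a chord
      \<open>e\<close> divides \<open>C\<close>. Both arcs together, minus one edge, form a proper
      and hence independent subset of \<open>C\<close> inside the span of the second arc. Counting
      leaves a single edge in the first arc, parallel to \<open>e\<close>.\<close>
    have small: "\<exists>x\<in>C. {e, x} \<notin> I"
      if D: "circuit n I D" "circuit n I D'" "e \<in> D" "e \<in> D'" "{e} \<in> I" "D - {e} \<subseteq> C" "D' - {e} \<subseteq> C"
        "(D - {e}) \<inter> (D' - {e}) = {}" "mspan n I (D - {e}) \<subseteq> mspan n I (D' - {e})" for D D' e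
    proof -
      have "D \<noteq> {e}" using D(5) nin[OF D(1)] by auto
      then obtain x where x: "x \<in> D - {e}" using D(3) by blast
      let ?X = "((D - {e}) \<union> (D' - {e})) - {x}"
      have fin: "finite D" "finite D'" using circuit_finite D(1,2) by auto
      have "?X \<subset> C" using x D(6,7) by blast
      then have XI: "?X \<in> I" by (rule C_proper)
      have "?X \<subseteq> mspan n I (D' - {e})"
        using D(9) circuit_subset_mspan[OF D(1,3)] circuit_subset_mspan[OF D(2,4)] by blast
      moreover have "D' - {e} \<in> I" using D(2,4) unfolding circuit_def by blast
      ultimately have "card ?X \<le> card (D' - {e})" using indep_in_mspan_card[OF M _ XI] by blast
      moreover have "card ?X = card ((D - {e}) \<union> (D' - {e})) - 1"
        using x fin by (subst card_Diff_singleton) auto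
      moreover have "card ((D - {e}) \<union> (D' - {e})) = card (D - {e}) + card (D' - {e})"
        using fin D(8) by (intro card_Un_disjoint) auto
      ultimately have "card (D - {e}) \<le> Suc 0" by linarith
      then have "D - {e} \<subseteq> {x}" using x fin by (auto simp: card_le_Suc0_iff_eq)
      then have "D = {e, x}" using x D(3) by blast
      then show ?thesis using nin[OF D(1)] x D(6) by blast
    qed
    have par: "\<exists>x\<in>C. {e, x} \<notin> I" if e: "e \<in> S" "e \<notin> C" "{e} \<in> I" for e
    proof -
      have dep_e: "insert e (C - {c}) \<notin> I" "insert e (C - {c}) \<subseteq> {..<n}"
        using e Cn unfolding S_def mspan_def by auto
      obtain D where D: "circuit n I D" "D \<subseteq> insert e (C - {c})"
        using dependent_contains_circuit[OF dep_e(2,1)] by blast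
      have eD: "e \<in> D"
      proof (rule ccontr)
        assume "e \<notin> D"
        then have "D \<in> I" using D(2) matroid_down[OF M Cc, of D] by blast
        then show False using nin[OF D(1)] by blast
      qed
      \<comment> \<open>The GF(2) sum of \<open>C\<close> and \<open>D\<close> consists of
        \<open>e\<close> and the complementary arc. It is dependent and so supplies the second
        circuit through \<open>e\<close>.\<close>
      let ?X = "(C - D) \<union> (D - C)"
      have X: "?X = insert e (C - (D - {e}))" using D(2) eD e(2) by blast
      have Xn: "?X \<subseteq> {..<n}" using Cn sub[OF D(1)] by blast
      have "?X \<notin> I"
        using Z_dep[OF Zdiff[OF CZ circuit_Z[OF D(1)]] _ Xn] X by blast
      then obtain D' where D': "circuit n I D'" "D' \<subseteq> ?X"
        using dependent_contains_circuit[OF Xn] by blast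
      have "D \<noteq> {e}" using e(3) nin[OF D(1)] by auto
      then have proper: "C - (D - {e}) \<subset> C" using eD D(2) e(2) by blast
      have eD': "e \<in> D'"
      proof (rule ccontr)
        assume "e \<notin> D'"
        then have "D' \<subset> C" using D'(2) X proper by blast
        then show False using C_proper nin[OF D'(1)] by blast
      qed
      have sub1: "D - {e} \<subseteq> C" "D' - {e} \<subseteq> C" using D(2) D'(2) X by auto
      have disj: "(D - {e}) \<inter> (D' - {e}) = {}" using D'(2) X by blast
      show ?thesis
        using schubert_mspan_chain[OF M schubert D(1) eD D'(1) eD']
          small[OF D(1) D'(1) eD eD' e(3) sub1 disj]
          small[OF D'(1) D(1) eD' eD e(3) sub1(2,1)] disj by (auto simp: Int_commute)
    qed
    have pair_circuit: "circuit n I {e, x}" if "{e, x} \<notin> I" "{e} \<in> I" "{x} \<in> I" for e x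
      using that matroid_subset[OF M that(2)] matroid_subset[OF M that(3)]
      unfolding circuit_def by (auto simp: insert_Diff_if)
    define Q where "Q = {e \<in> S. e \<notin> C \<and> {e} \<in> I}"
    \<comment> \<open>\<open>par\<close> gives each element of \<open>Q\<close> its own partner in
      \<open>C\<close>; here a single partner is made to serve all of them.\<close>
    have "\<exists>c0\<in>C. \<forall>e\<in>Q. Z {e, c0}"
    proof (cases "Q = {}")
      case True
      then show ?thesis using c by blast
    next
      case False
      then obtain e0 where "e0 \<in> Q" by blast
      then have e0: "e0 \<notin> C" "{e0} \<in> I" "e0 \<in> S" unfolding Q_def by auto
      then obtain c0 where c0: "c0 \<in> C" "{e0, c0} \<notin> I" using par by blast
      have "Z {e, c0}" if "e \<in> Q" for e
      proof -
        have e: "e \<notin> C" "{e} \<in> I" "e \<in> S" using that unfolding Q_def by auto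
        then obtain c1 where c1: "c1 \<in> C" "{e, c1} \<notin> I" using par by blast
        have circ0: "circuit n I {e0, c0}" and circ1: "circuit n I {e, c1}"
          using pair_circuit e0 e c0 c1 C_single by auto
        have Z1: "Z {e, c1}" by (rule circuit_Z[OF circ1])
        show ?thesis
        proof (cases "c1 = c0")
          case True
          then show ?thesis using Z1 by simp
        next
          case False
          have eq: "{e0, c0} - {e0} = {c0}" "{e, c1} - {e} = {c1}" using e e0 c0 c1 by auto
          have in0: "c0 \<in> mspan n I {c0}" "c1 \<in> mspan n I {c1}"
            using c0 c1 Cn unfolding mspan_def by auto
          have "mspan n I {c0} \<subseteq> mspan n I {c1} \<or> mspan n I {c1} \<subseteq> mspan n I {c0}"
            using schubert_mspan_chain[OF M schubert circ0 _ circ1, of e0 e] eq by simp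
          then have "c0 \<in> mspan n I {c1} \<or> c1 \<in> mspan n I {c0}" using in0 by blast
          \<comment> \<open>Two different partners are parallel to each other. Then \<open>C\<close>
            consists of just these two edges, and adding \<open>C\<close> moves the partner of
            \<open>e\<close> from \<open>c1\<close> to \<open>c0\<close>.\<close>
          then have dep01: "{c0, c1} \<notin> I" using False unfolding mspan_def by (auto simp: insert_commute)
          have "{c0, c1} = C" by (rule circuit_eq[OF C(1) _ dep01]) (use c0 c1 in simp)
          then have "Z {c0, c1}" using CZ by simp
          then have "Z (({e, c1} - {c0, c1}) \<union> ({c0, c1} - {e, c1}))" by (rule Zdiff[OF Z1])
          moreover have "({e, c1} - {c0, c1}) \<union> ({c0, c1} - {e, c1}) = {e, c0}"
            using False e c0 c1 by auto
          ultimately show ?thesis by simp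
        qed
      qed
      then show ?thesis using c0 by blast
    qed
    then obtain c0 where c0: "c0 \<in> C" and Q_par: "\<And>e. e \<in> Q \<Longrightarrow> Z {e, c0}" by blast
    define R P where "R = C - {c0}" and "P = insert c0 Q"
    have QC: "Q \<inter> C = {}" unfolding Q_def by blast
    have Sn: "S \<subseteq> {..<n}" unfolding S_def mspan_def by auto
    have CL: "C \<inter> L = {}" using C_single unfolding L_def by blast
    have parts: "theta_parts n R P L"
      using Cn Sn c0 CL QC unfolding theta_parts_def R_def P_def Q_def L_def by auto
    have S_cover: "S \<subseteq> R \<union> P \<union> L"
      using Sn unfolding R_def P_def Q_def L_def by auto
    have PZ: "Z (insert p R)" if "p \<in> P" for p
    proof (cases "p = c0")
      case True
      then have "insert p R = C" using c0 unfolding R_def by blast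
      then show ?thesis using CZ by simp
    next
      case False
      then have p: "p \<in> Q" using that unfolding P_def by blast
      have "insert p R = (C - {p, c0}) \<union> ({p, c0} - C)"
        using p QC c0 unfolding R_def by blast
      then show ?thesis using Zdiff[OF CZ Q_par[OF p]] by simp
    qed
    have PPZ: "Z {p, q}" if pq: "p \<in> P" "q \<in> P" "p \<noteq> q" for p q
    proof (cases "p = c0 \<or> q = c0")
      case True
      moreover have "Z {c0, e}" if "e \<in> Q" for e
        using Q_par[OF that] by (simp add: insert_commute)
      ultimately show ?thesis using Q_par pq unfolding P_def by auto
    next
      case False
      then have "Z {p, c0}" "Z {q, c0}" using Q_par pq unfolding P_def by auto
      then have "Z (({p, c0} - {q, c0}) \<union> ({q, c0} - {p, c0}))" by (rule Zdiff)
      moreover have "({p, c0} - {q, c0}) \<union> ({q, c0} - {p, c0}) = {p, q}" using False pq by auto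
      ultimately show ?thesis by simp
    qed
    have Pn: "P \<subseteq> {..<n}" "R \<subseteq> {..<n}" using parts unfolding theta_parts_def by auto
    have "A \<in> I \<longleftrightarrow> A \<in> theta n R P L" for A
    proof
      assume A: "A \<in> I"
      have An: "A \<subseteq> {..<n}" by (rule matroid_subset[OF M A])
      have noZ: "\<not> Z X" if "X \<subseteq> A" "X \<noteq> {}" for X
        using Z_dep[of X] matroid_down[OF M A that(1)] that An by blast
      have "card (A \<inter> P) \<le> 1"
      proof (rule ccontr)
        assume "\<not> card (A \<inter> P) \<le> 1"
        then obtain p q where "p \<in> A \<inter> P" "q \<in> A \<inter> P" "p \<noteq> q"
          using card_gt_1_two_elements by (metis linorder_not_less)
        then show False using PPZ noZ[of "{p, q}"] by auto
      qed
      moreover have "\<not> (R \<subseteq> A \<and> A \<inter> P \<noteq> {})"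
      proof
        assume R: "R \<subseteq> A \<and> A \<inter> P \<noteq> {}"
        then obtain p where "p \<in> A" "p \<in> P" by blast
        then show False using PZ[of p] noZ[of "insert p R"] R by blast
      qed
      ultimately show "A \<in> theta n R P L" using An L_dep[OF A] unfolding theta_def by blast
    next
      assume A: "A \<in> theta n R P L"
      then have An: "A \<subseteq> {..<n}" and AL: "A \<inter> L = {}" and AP: "card (A \<inter> P) \<le> 1"
        and AR: "\<not> (R \<subseteq> A \<and> A \<inter> P \<noteq> {})" unfolding theta_def by auto
      show "A \<in> I"
      proof (rule ccontr)
        assume "A \<notin> I"
        then obtain D where D: "circuit n I D" "D \<subseteq> A"
          using dependent_contains_circuit[OF An] by blast
        have DRP: "D \<subseteq> R \<union> P" using circ_S[OF D(1)] S_cover D(2) AL by blast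
        have "R \<subset> C" using c0 unfolding R_def by blast
        then have "\<not> D \<subseteq> R" using C_proper[of D] nin[OF D(1)] by blast
        then obtain p where p: "p \<in> D" "p \<in> P" using DRP by blast
        have "finite (A \<inter> P)" using An finite_subset by blast
        then have "A \<inter> P \<subseteq> {p}" using AP p D(2) by (auto simp: card_le_Suc0_iff_eq)
        then have DR: "D \<subseteq> insert p R" using DRP D(2) by blast
        have DZ: "Z D" by (rule circuit_Z[OF D(1)])
        have "R \<subseteq> D"
        proof (cases "p = c0")
          case True
          then have "D \<subseteq> C" using DR c0 unfolding R_def by blast
          then have "D = C" using circuit_eq[OF C(1)] nin[OF D(1)] by blast
          then show ?thesis unfolding R_def by blast
        next
          case False
          then have pQ: "p \<in> Q" using p unfolding P_def by blast
          \<comment> \<open>Adding \<open>{p, c0}\<close> over GF(2) exchanges \<open>p\<close> for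
            \<open>c0\<close> and carries \<open>D\<close> into \<open>C\<close>, where minimality
            of \<open>C\<close> applies.\<close>
          let ?X = "(D - {p, c0}) \<union> ({p, c0} - D)"
          have c0D: "c0 \<notin> D" using DR False unfolding R_def by blast
          have XC: "?X \<subseteq> C" using DR c0 p unfolding R_def by blast
          have "?X \<notin> I"
            using Z_dep[OF Zdiff[OF DZ Q_par[OF pQ]]] XC Cn c0D by blast
          then have "?X = C" using circuit_eq[OF C(1) XC] by blast
          then have "C - {c0} \<subseteq> D" using p(1) by blast
          then show ?thesis unfolding R_def .
        qed
        then show False using AR p D(2) by blast
      qed
    qed
    then have "I = theta n R P L" by blast
    moreover have "R \<noteq> {}"
    proof
      assume "R = {}"
      then have "C \<subseteq> {c0}" unfolding R_def by blast
      then show False using C(2) card_mono[of "{c0}" C] by simp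
    qed
    moreover have "P \<noteq> {}" unfolding P_def by blast
    ultimately show ?thesis using that[OF parts] by blast
  qed
qed

section \<open>Tutte polynomials\<close>

definition xvar :: "int poly poly" where "xvar = [:[:0, 1:]:]"
definition yvar :: "int poly poly" where "yvar = [:0, 1:]"

lemma tutte_xvar_yvar:
  "tutte n I = (\<Sum>A\<in>Pow {..<n}. (xvar - 1) ^ (mrank I {..<n} - mrank I A) * (yvar - 1) ^ (card A - mrank I A))"
proof -
  have "xvar - 1 = [:[:-1, 1:]:]" "yvar - 1 = [:[:-1:], 1:]"
    by (simp_all add: xvar_def yvar_def one_pCons)
  then show ?thesis unfolding tutte_def by simp
qed

lemma coeff_xvar_yvar: "coeff (coeff (xvar ^ i * yvar ^ j) b) a = of_bool (a = i \<and> b = j)"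
proof -
  have "xvar ^ i = [:monom 1 i:]" for i
    by (induction i) (simp_all add: xvar_def one_pCons monom_Suc monom_0)
  moreover have "yvar ^ j = monom 1 j"
    unfolding yvar_def by (simp add: monom_altdef)
  ultimately show ?thesis by (auto simp: coeff_monom)
qed

lemma xvar_neq_1: "xvar - 1 \<noteq> 0" and yvar_neq_1: "yvar - 1 \<noteq> 0"
  by (simp_all add: xvar_def yvar_def one_pCons)

text \<open>Evaluation at \<open>x = y = 2\<close>, where \<open>x - 1 = y - 1 = 1\<close>.\<close>
definition ev2 :: "int poly poly \<Rightarrow> int" where "ev2 p = poly (poly p [:2:]) 2"

lemma ev2_simps [simp]:
  "ev2 (p + q) = ev2 p + ev2 q" "ev2 (p - q) = ev2 p - ev2 q" "ev2 (p * q) = ev2 p * ev2 q"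
  "ev2 (p ^ j) = ev2 p ^ j" "ev2 1 = 1" "ev2 0 = 0" "ev2 xvar = 2" "ev2 yvar = 2"
  by (simp_all add: ev2_def xvar_def yvar_def)

lemma ev2_sum [simp]: "ev2 (sum f A) = (\<Sum>a\<in>A. ev2 (f a))"
  by (induction A rule: infinite_finite_induct) simp_all

lemma ev2_of_int [simp]: "ev2 (of_int c) = c"
  by (simp add: ev2_def of_int_poly)

text \<open>Every subset contributes 1. Since this value is common to all matroids on n elements, it
  reveals the coefficient sum of a linear relation.\<close>

lemma ev2_tutte: "ev2 (tutte n I) = 2 ^ n"
  unfolding tutte_xvar_yvar by (simp add: card_Pow)

lemma sum_Pow_power_card:
  fixes v :: "'a::comm_semiring_1"
  assumes "finite J"
  shows "(\<Sum>Y\<in>Pow J. v ^ card Y) = (1 + v) ^ card J"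
  using assms
proof (induction J)
  case (insert a J)
  have "(\<Sum>Y\<in>Pow (insert a J). v ^ card Y) = (\<Sum>Y\<in>Pow J. v ^ card Y) + (\<Sum>Y\<in>insert a ` Pow J. v ^ card Y)"
    unfolding Pow_insert using insert.hyps by (intro sum.union_disjoint) auto
  also have "(\<Sum>Y\<in>insert a ` Pow J. v ^ card Y) = (\<Sum>Y\<in>Pow J. v ^ card (insert a Y))"
    using insert.hyps by (subst sum.reindex) (auto simp: inj_on_def insert_ident)
  also have "\<dots> = (\<Sum>Y\<in>Pow J. v * v ^ card Y)"
  proof (rule sum.cong)
    fix Y assume Y: "Y \<in> Pow J"
    then have "finite Y" "a \<notin> Y" using insert.hyps finite_subset by auto
    then show "v ^ card (insert a Y) = v * v ^ card Y" by simp
  qed simp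
  finally show ?case using insert by (simp add: sum_distrib_left[symmetric] algebra_simps)
qed simp

lemma sum_Pow_power_card_compl:
  fixes u :: "'a::comm_semiring_1"
  assumes "finite K"
  shows "(\<Sum>X\<in>Pow K. u ^ card (K - X)) = (1 + u) ^ card K"
proof -
  have "(\<Sum>X\<in>Pow K. u ^ card (K - X)) = (\<Sum>X\<in>Pow K. u ^ card X)"
    by (rule sum.reindex_bij_witness[of _ "\<lambda>X. K - X" "\<lambda>X. K - X"]) (auto simp: double_diff)
  then show ?thesis using sum_Pow_power_card[OF assms] by simp
qed

lemma sum_Pow_split:
  assumes "K \<inter> J = {}"
  shows "(\<Sum>A\<in>Pow (K \<union> J). f A) = (\<Sum>X\<in>Pow K. \<Sum>Y\<in>Pow J. f (X \<union> Y))"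
proof -
  have "(\<Sum>(X, Y)\<in>Pow K \<times> Pow J. f (X \<union> Y)) = (\<Sum>A\<in>Pow (K \<union> J). f A)"
    by (rule sum.reindex_bij_witness[of _ "\<lambda>A. (A \<inter> K, A \<inter> J)" "\<lambda>(X, Y). X \<union> Y"])
      (use assms in auto)
  then show ?thesis by (simp add: sum.cartesian_product)
qed

text \<open>The complement \<open>?K\<close> of \<open>P \<union> L\<close> is a basis. For
  \<open>X\<close> inside and \<open>Y\<close> outside it, the rank of \<open>X \<union> Y\<close>
  exceeds \<open>card X\<close> by 0 or 1, and this excess is a condition on \<open>X\<close> times
  a condition on \<open>Y\<close>; so the double sum factors.\<close>

lemma tutte_theta:
  assumes parts: "theta_parts n R P L" and rank: "matroid_rank n (theta n R P L) = k"
  shows "(xvar - 1) * (yvar - 1) * tutte n (theta n R P L) =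
    (xvar - 1) * (yvar - 1) * (xvar ^ k * yvar ^ (n - k)) +
    (1 - (xvar - 1) * (yvar - 1)) *
      ((xvar ^ k - xvar ^ (k - card R)) * (yvar ^ (n - k) - yvar ^ (n - k - card P)))"
proof -
  define u v where "u = xvar - 1" and "v = yvar - 1"
  let ?I = "theta n R P L"
  let ?K = "{..<n} - P - L" let ?J = "P \<union> L"
  have p: "R \<subseteq> ?K" "P \<subseteq> {..<n}" "L \<subseteq> {..<n}" "P \<inter> L = {}"
    using parts unfolding theta_parts_def by auto
  have fin: "finite P" "finite L" "finite R" "finite ?K" "finite ?J"
    using p finite_subset[of _ "{..<n}"] by (auto intro: finite_subset)
  have KJ: "?K \<inter> ?J = {}" "?K \<union> ?J = {..<n}" using p by auto
  have cJ: "card ?J = card P + card L" using fin p by (intro card_Un_disjoint)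
  have cn: "card ?K + card ?J = n"
    using card_Un_disjoint[of ?K ?J] fin KJ by simp
  have ck: "card ?K = k"
    using rank mrank_theta[OF parts subset_refl] p unfolding matroid_rank_def by auto
  have cJ': "card ?J = n - k" using cn ck by simp
  have uv: "1 + u = xvar" "1 + v = yvar" unfolding u_def v_def by simp_all
  have sK: "(\<Sum>X\<in>Pow ?K. u ^ card (?K - X)) = xvar ^ k"
    using sum_Pow_power_card_compl[OF fin(4), of u] unfolding uv ck .
  have sJ: "(\<Sum>Y\<in>Pow ?J. v ^ card Y) = yvar ^ (n - k)"
    using sum_Pow_power_card[OF fin(5), of v] unfolding uv cJ' .
  have rE: "mrank ?I {..<n} = k" using rank unfolding matroid_rank_def .
  \<comment> \<open>The excess of the rank over \<open>card X\<close>. An excess of 1 divides the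
    summand by \<open>u * v\<close>; the factor \<open>u * v\<close> in front absorbs this, leaving
    \<open>u * v + (1 - u * v) * \<chi> X Y\<close>.\<close>
  define \<chi> where "\<chi> X Y = (if R \<subseteq> X \<or> Y \<inter> P = {} then 0 else 1 :: int poly poly)" for X Y
  have factor: "\<chi> X Y = (1 - of_bool (R \<subseteq> X)) * (1 - of_bool (Y \<inter> P = {}))" for X Y
    unfolding \<chi>_def by auto
  have "u * v * tutte n ?I = (\<Sum>A\<in>Pow (?K \<union> ?J). u * v * (u ^ (k - mrank ?I A) * v ^ (card A - mrank ?I A)))"
    unfolding tutte_xvar_yvar u_def[symmetric] v_def[symmetric] rE KJ(2) by (simp add: sum_distrib_left)
  also have "\<dots> = (\<Sum>X\<in>Pow ?K. \<Sum>Y\<in>Pow ?J.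
      u * v * (u ^ (k - mrank ?I (X \<union> Y)) * v ^ (card (X \<union> Y) - mrank ?I (X \<union> Y))))"
    by (rule sum_Pow_split[OF KJ(1)])
  also have "\<dots> = (\<Sum>X\<in>Pow ?K. \<Sum>Y\<in>Pow ?J.
      u ^ card (?K - X) * v ^ card Y * (u * v + (1 - u * v) * \<chi> X Y))"
  proof (intro sum.cong refl)
    fix X Y assume "X \<in> Pow ?K" "Y \<in> Pow ?J"
    then have XY: "X \<subseteq> ?K" "Y \<subseteq> ?J" by auto
    then have f: "finite X" "finite Y" using fin finite_subset by blast+
    have card: "card (X \<union> Y) = card X + card Y"
      using f XY KJ(1) by (intro card_Un_disjoint) auto
    have XYn: "X \<union> Y \<subseteq> {..<n}" using XY p by auto
    have s: "X \<union> Y - P - L = X" "(X \<union> Y) \<inter> P = Y \<inter> P" "R \<subseteq> X \<union> Y \<longleftrightarrow> R \<subseteq> X"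
      using XY p by auto
    have cX: "card (?K - X) = k - card X" using f XY(1) ck by (simp add: card_Diff_subset)
    have r: "mrank ?I (X \<union> Y) = card X + (if Y \<inter> P \<noteq> {} \<and> \<not> R \<subseteq> X then 1 else 0)"
      using mrank_theta[OF parts XYn] unfolding s .
    show "u * v * (u ^ (k - mrank ?I (X \<union> Y)) * v ^ (card (X \<union> Y) - mrank ?I (X \<union> Y))) =
      u ^ card (?K - X) * v ^ card Y * (u * v + (1 - u * v) * \<chi> X Y)"
    proof (cases "Y \<inter> P \<noteq> {} \<and> \<not> R \<subseteq> X")
      case True
      \<comment> \<open>Both exponents are positive in this case, so lowering them by one is not
        truncated.\<close>
      then have "X \<subset> ?K" using XY(1) p(1) by blast
      then have "card X < k" using psubset_card_mono[OF fin(4)] ck by metis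
      then have a: "k - card X = Suc (k - (card X + 1))" by simp
      have "0 < card Y" using True f by (auto simp: card_gt_0_iff)
      then have b: "card Y = Suc (card X + card Y - (card X + 1))" by simp
      have "u ^ card (?K - X) = u * u ^ (k - (card X + 1))" unfolding cX by (subst a) simp
      moreover have "v ^ card Y = v * v ^ (card X + card Y - (card X + 1))" by (subst b) simp
      ultimately show ?thesis using True r card unfolding \<chi>_def by (simp add: algebra_simps)
    next
      case False
      then show ?thesis using r card cX unfolding \<chi>_def by (auto simp: algebra_simps)
    qed
  qed
  also have "\<dots> = u * v * ((\<Sum>X\<in>Pow ?K. u ^ card (?K - X)) * (\<Sum>Y\<in>Pow ?J. v ^ card Y)) +
      (1 - u * v) * ((\<Sum>X\<in>Pow ?K. u ^ card (?K - X) * (1 - of_bool (R \<subseteq> X))) *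
        (\<Sum>Y\<in>Pow ?J. v ^ card Y * (1 - of_bool (Y \<inter> P = {}))))"
    unfolding factor sum_product
    unfolding sum_distrib_left sum.distrib[symmetric]
    by (intro sum.cong refl) (simp add: algebra_simps)
  also have "(\<Sum>X\<in>Pow ?K. u ^ card (?K - X)) = xvar ^ k" by (rule sK)
  also have "(\<Sum>Y\<in>Pow ?J. v ^ card Y) = yvar ^ (n - k)" by (rule sJ)
  also have "(\<Sum>X\<in>Pow ?K. u ^ card (?K - X) * (1 - of_bool (R \<subseteq> X))) = xvar ^ k - xvar ^ (k - card R)"
  proof -
    have "(\<Sum>X\<in>Pow ?K. u ^ card (?K - X) * of_bool (R \<subseteq> X)) = (\<Sum>X\<in>{X \<in> Pow ?K. R \<subseteq> X}. u ^ card (?K - X))"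
      using fin(4) by (intro sum.mono_neutral_cong_right) auto
    also have "\<dots> = (\<Sum>X\<in>Pow (?K - R). u ^ card (?K - R - X))"
      by (rule sum.reindex_bij_witness[of _ "\<lambda>X. X \<union> R" "\<lambda>X. X - R"])
        (use p(1) in \<open>auto intro!: arg_cong[of _ _ card] arg_cong[of _ _ "\<lambda>m. u ^ card m"]\<close>)
    also have "\<dots> = xvar ^ card (?K - R)"
      using sum_Pow_power_card_compl[of "?K - R" u] fin by (simp add: uv)
    also have "card (?K - R) = k - card R" using fin p(1) ck by (simp add: card_Diff_subset)
    finally show ?thesis
      using sK by (simp add: right_diff_distrib sum_subtractf)
  qed
  also have "(\<Sum>Y\<in>Pow ?J. v ^ card Y * (1 - of_bool (Y \<inter> P = {}))) = yvar ^ (n - k) - yvar ^ (n - k - card P)"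
  proof -
    have "(\<Sum>Y\<in>Pow ?J. v ^ card Y * of_bool (Y \<inter> P = {})) = (\<Sum>Y\<in>Pow L. v ^ card Y)"
      using fin(5) p(4) by (intro sum.mono_neutral_cong_right) auto
    also have "\<dots> = yvar ^ card L"
      using sum_Pow_power_card[of L v] fin by (simp add: uv)
    also have "card L = n - k - card P" using cJ cJ' by simp
    finally show ?thesis
      using sJ by (simp add: right_diff_distrib sum_subtractf)
  qed
  finally show ?thesis unfolding u_def v_def .
qed

section \<open>Relabelling and standard representatives of the shapes\<close>

lemma image_in_theta_iff:
  assumes f: "bij_betw f {..<n} {..<n}" and parts: "theta_parts n R P L" and A: "A \<subseteq> {..<n}"
  shows "f ` A \<in> theta n (f ` R) (f ` P) (f ` L) \<longleftrightarrow> A \<in> theta n R P L"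
proof -
  have inj: "inj_on f {..<n}" and im: "f ` {..<n} = {..<n}" using f unfolding bij_betw_def by auto
  have s: "R \<subseteq> {..<n}" "P \<subseteq> {..<n}" "L \<subseteq> {..<n}" using parts unfolding theta_parts_def by auto
  have "f ` A \<subseteq> {..<n}" using A im by blast
  moreover have i: "f ` A \<inter> f ` X = f ` (A \<inter> X)" if "X \<subseteq> {..<n}" for X
    using inj_on_image_Int[OF inj A that] by simp
  moreover have "card (f ` (A \<inter> P)) = card (A \<inter> P)"
    using A by (intro card_image inj_on_subset[OF inj]) auto
  moreover have "f ` R \<subseteq> f ` A \<longleftrightarrow> R \<subseteq> A"
  proof -
    have "f ` R \<subseteq> f ` A \<longleftrightarrow> (\<forall>x\<in>R. f x \<in> f ` A)" by blast
    also have "\<dots> \<longleftrightarrow> (\<forall>x\<in>R. x \<in> A)"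
      using inj_on_image_mem_iff[OF inj _ A] s(1) by (intro ball_cong refl) blast
    finally show ?thesis by blast
  qed
  ultimately show ?thesis using A s unfolding theta_def by (simp add: i)
qed

lemma theta_parts_image:
  assumes f: "bij_betw f {..<n} {..<n}" and parts: "theta_parts n R P L"
  shows "theta_parts n (f ` R) (f ` P) (f ` L)"
proof -
  have inj: "inj_on f {..<n}" and im: "f ` {..<n} = {..<n}" using f unfolding bij_betw_def by auto
  have i: "f ` X \<inter> f ` Y = f ` (X \<inter> Y)" if "X \<subseteq> {..<n}" "Y \<subseteq> {..<n}" for X Y
    using inj_on_image_Int[OF inj that] by simp
  have s: "R \<subseteq> {..<n}" "P \<subseteq> {..<n}" "L \<subseteq> {..<n}" using parts unfolding theta_parts_def by auto
  then have "f ` R \<subseteq> {..<n}" "f ` P \<subseteq> {..<n}" "f ` L \<subseteq> {..<n}" using im by blast+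
  then show ?thesis using parts s unfolding theta_parts_def by (simp add: i)
qed

lemma matroid_iso_theta:
  assumes f: "bij_betw f {..<n} {..<n}" "\<forall>A. A \<subseteq> {..<n} \<longrightarrow> (A \<in> theta n R P L \<longleftrightarrow> f ` A \<in> J)"
    and parts: "theta_parts n R P L" and J: "matroid n J"
  shows "J = theta n (f ` R) (f ` P) (f ` L)"
proof -
  have "B \<in> J \<longleftrightarrow> B \<in> theta n (f ` R) (f ` P) (f ` L)" if "B \<subseteq> {..<n}" for B
  proof -
    have "B \<subseteq> f ` {..<n}" using that f(1) by (simp add: bij_betw_imp_surj_on)
    then obtain A where A: "A \<subseteq> {..<n}" "B = f ` A" by (rule subset_imageE)
    then show ?thesis using f(2) image_in_theta_iff[OF f(1) parts A(1)] by simp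
  qed
  moreover have "B \<subseteq> {..<n}" if "B \<in> theta n (f ` R) (f ` P) (f ` L)" for B
    using that unfolding theta_def by simp
  ultimately show ?thesis using matroid_subset[OF J] by blast
qed

text \<open>Bijections between corresponding parts are glued; the numbers of remaining elements
  agree because the other three numbers do.\<close>

lemma matroid_iso_theta_theta:
  assumes 1: "theta_parts n R P L" and 2: "theta_parts n R' P' L'"
    and c: "card R = card R'" "card P = card P'" "card L = card L'"
  shows "matroid_iso n (theta n R P L) (theta n R' P' L')"
proof -
  let ?C = "{..<n} - (R \<union> P \<union> L)" and ?C' = "{..<n} - (R' \<union> P' \<union> L')"
  have s1: "R \<subseteq> {..<n}" "P \<subseteq> {..<n}" "L \<subseteq> {..<n}" "R \<inter> P = {}" "R \<inter> L = {}" "P \<inter> L = {}"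
    using 1 unfolding theta_parts_def by auto
  have s2: "R' \<subseteq> {..<n}" "P' \<subseteq> {..<n}" "L' \<subseteq> {..<n}" "R' \<inter> P' = {}" "R' \<inter> L' = {}" "P' \<inter> L' = {}"
    using 2 unfolding theta_parts_def by auto
  have fin: "finite R" "finite P" "finite L" "finite R'" "finite P'" "finite L'"
    using s1 s2 finite_subset[OF _ finite_lessThan] by auto
  have cU: "card (R \<union> P \<union> L) = card R + card P + card L"
    using s1 fin by (subst card_Un_disjoint; auto simp: card_Un_disjoint)
  have cU': "card (R' \<union> P' \<union> L') = card R' + card P' + card L'"
    using s2 fin by (subst card_Un_disjoint; auto simp: card_Un_disjoint)
  have "card ?C = n - card (R \<union> P \<union> L)" using s1 fin by (subst card_Diff_subset) auto
  moreover have "card ?C' = n - card (R' \<union> P' \<union> L')" using s2 fin by (subst card_Diff_subset) auto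
  ultimately have cC: "card ?C = card ?C'" using cU cU' c by simp
  obtain a where a: "bij_betw a R R'" using finite_same_card_bij[OF fin(1,4) c(1)] by blast
  obtain b where b: "bij_betw b P P'" using finite_same_card_bij[OF fin(2,5) c(2)] by blast
  obtain d where d: "bij_betw d L L'" using finite_same_card_bij[OF fin(3,6) c(3)] by blast
  obtain e where e: "bij_betw e ?C ?C'" using finite_same_card_bij[OF _ _ cC] by blast
  define f where "f x = (if x \<in> R then a x else if x \<in> P then b x else if x \<in> L then d x else e x)" for x
  have fR: "bij_betw f R R'" using a by (subst bij_betw_cong[of _ f a]) (auto simp: f_def)
  have fP: "bij_betw f P P'" using b s1 by (subst bij_betw_cong[of _ f b]) (auto simp: f_def)
  have fL: "bij_betw f L L'" using d s1 by (subst bij_betw_cong[of _ f d]) (auto simp: f_def)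
  have fC: "bij_betw f ?C ?C'" using e by (subst bij_betw_cong[of _ f e]) (auto simp: f_def)
  note im = fR[THEN bij_betw_imp_surj_on] fP[THEN bij_betw_imp_surj_on] fL[THEN bij_betw_imp_surj_on]
  have "bij_betw f (R \<union> P) (R' \<union> P')" by (rule bij_betw_combine[OF fR fP s2(4)])
  then have "bij_betw f (R \<union> P \<union> L) (R' \<union> P' \<union> L')"
    by (rule bij_betw_combine[OF _ fL]) (use s2 in blast)
  then have "bij_betw f (R \<union> P \<union> L \<union> ?C) (R' \<union> P' \<union> L' \<union> ?C')"
    by (rule bij_betw_combine[OF _ fC]) blast
  moreover have "R \<union> P \<union> L \<union> ?C = {..<n}" using s1(1-3) by blast
  moreover have "R' \<union> P' \<union> L' \<union> ?C' = {..<n}" using s2(1-3) by blast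
  ultimately have f: "bij_betw f {..<n} {..<n}" by simp
  have "A \<in> theta n R P L \<longleftrightarrow> f ` A \<in> theta n R' P' L'" if "A \<subseteq> {..<n}" for A
    using image_in_theta_iff[OF f 1 that] unfolding im by simp
  then show ?thesis unfolding matroid_iso_def using f by blast
qed

text \<open>Keeping \<open>{..<k}\<close> a basis for every admissible shape fixes the rank at
  \<open>k\<close>: path elements are taken from it, and its other elements are coloops.\<close>

definition std_theta :: "nat \<Rightarrow> nat \<Rightarrow> nat \<times> nat \<Rightarrow> nat set set" where
  "std_theta n k p = theta n {..<fst p} {k..<k + snd p} {k + snd p..<n}"

text \<open>A pair \<open>(r, m)\<close> stands for a path of \<open>r\<close> edges closed by \<open>m\<close> parallel edges; \<open>(0, 0)\<close> is the
  matroid with coloops and loops only.\<close>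
definition theta_index :: "nat \<Rightarrow> nat \<Rightarrow> (nat \<times> nat) set" where
  "theta_index n k = insert (0, 0) ({1..k} \<times> {1..n - k})"

lemma std_theta_parts:
  assumes "k \<le> n" "r \<le> k" "m \<le> n - k"
  shows "theta_parts n {..<r} {k..<k + m} {k + m..<n}"
  using assms unfolding theta_parts_def by auto

lemma matroid_rank_std_theta:
  assumes "k \<le> n" "r \<le> k" "m \<le> n - k"
  shows "matroid_rank n (std_theta n k (r, m)) = k"
  using matroid_rank_theta[OF std_theta_parts[OF assms]] assms by (simp add: std_theta_def)

lemma tutte_std_theta:
  assumes "k \<le> n" "r \<le> k" "m \<le> n - k"
  shows "(xvar - 1) * (yvar - 1) * tutte n (std_theta n k (r, m)) =
    (xvar - 1) * (yvar - 1) * (xvar ^ k * yvar ^ (n - k)) +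
    (1 - (xvar - 1) * (yvar - 1)) *
      ((xvar ^ k - xvar ^ (k - r)) * (yvar ^ (n - k) - yvar ^ (n - k - m)))"
proof -
  have "matroid_rank n (theta n {..<r} {k..<k + m} {k + m..<n}) = k"
    using matroid_rank_std_theta[OF assms] by (simp add: std_theta_def)
  from tutte_theta[OF std_theta_parts[OF assms] this] show ?thesis
    by (simp only: std_theta_def fst_conv snd_conv card_lessThan card_atLeastLessThan add_diff_cancel_left')
qed

lemma theta_part_cards:
  assumes parts: "theta_parts n R P L" and rank: "matroid_rank n (theta n R P L) = k"
  shows "card R \<le> k" "card P + card L = n - k" "k \<le> n"
proof -
  have s: "R \<subseteq> {..<n} - (P \<union> L)" "P \<union> L \<subseteq> {..<n}" "P \<inter> L = {}"
    using parts unfolding theta_parts_def by auto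
  have fin: "finite P" "finite L" using s finite_subset[OF _ finite_lessThan] by auto
  have cU: "card (P \<union> L) = card P + card L" using fin s(3) by (rule card_Un_disjoint)
  have le: "card (P \<union> L) \<le> n" using card_mono[OF _ s(2)] by simp
  have k: "n - card P - card L = k" using matroid_rank_theta[OF parts] rank by simp
  have "card ({..<n} - (P \<union> L)) = n - card (P \<union> L)" using fin s(2) by (subst card_Diff_subset) auto
  then show "card R \<le> k" using card_mono[OF _ s(1)] cU k by simp
  show "card P + card L = n - k" "k \<le> n" using k cU le by auto
qed

text \<open>The closed formula involves only \<open>card R\<close>, \<open>card P\<close>,
  \<open>n\<close> and \<open>k\<close>, and its nonzero factor
  \<open>(xvar - 1) * (yvar - 1)\<close> cancels.\<close>

lemma tutte_theta_std:
  assumes parts: "theta_parts n R P L" and rank: "matroid_rank n (theta n R P L) = k"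
  shows "tutte n (theta n R P L) = tutte n (std_theta n k (card R, card P))"
proof -
  note c = theta_part_cards[OF parts rank]
  have "card P \<le> n - k" using c(2) by simp
  then have "(xvar - 1) * (yvar - 1) * tutte n (theta n R P L) =
    (xvar - 1) * (yvar - 1) * tutte n (std_theta n k (card R, card P))"
    using tutte_theta[OF parts rank] tutte_std_theta[OF c(3,1), of "card P"] by simp
  then show ?thesis using xvar_neq_1 yvar_neq_1 by simp
qed

section \<open>Linear independence of the Tutte polynomials of the shapes\<close>

lemma coeff_of_int_mult: "coeff (coeff (of_int c * p) b) a = c * coeff (coeff p b) a"
  for p :: "int poly poly"
  by (simp add: of_int_poly)

text \<open>The expansion is \<open>x + y - x y\<close>, whose coefficient at \<open>x\<close> is
  1.\<close>

lemma weight_neq_0: "1 - (xvar - 1) * (yvar - 1) \<noteq> 0"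
proof
  assume "1 - (xvar - 1) * (yvar - 1) = 0"
  then have "xvar ^ 1 * yvar ^ 0 + xvar ^ 0 * yvar ^ 1 - xvar ^ 1 * yvar ^ 1 = 0"
    by (simp add: algebra_simps)
  then have "coeff (coeff (xvar ^ 1 * yvar ^ 0 + xvar ^ 0 * yvar ^ 1 - xvar ^ 1 * yvar ^ 1) 0) 1 = 0"
    by (simp only: coeff_0)
  then show False by (simp only: coeff_add coeff_diff coeff_xvar_yvar) simp
qed

text \<open>Evaluation at \<open>x = y = 2\<close> makes the coefficients sum to 0; then the common
  term \<open>x^k y^(n-k)\<close> drops out and the weight cancels. In what remains, each
  \<open>?W p\<close> with \<open>p \<noteq> (0, 0)\<close> has exactly one monomial free of both
  \<open>x^k\<close> and \<open>y^(n-k)\<close>, and its exponents determine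
  \<open>p\<close>.\<close>

lemma std_theta_tutte_independent:
  assumes k: "k \<le> n" and zero: "(\<Sum>p\<in>theta_index n k. of_int (a p) * tutte n (std_theta n k p)) = 0"
    and p: "p \<in> theta_index n k"
  shows "a p = 0"
proof -
  let ?X = "theta_index n k" and ?T = "\<lambda>p. tutte n (std_theta n k p)"
  let ?W = "\<lambda>p. (xvar ^ k - xvar ^ (k - fst p)) * (yvar ^ (n - k) - yvar ^ (n - k - snd p))"
  let ?uv = "(xvar - 1) * (yvar - 1)"
  have fin: "finite ?X" unfolding theta_index_def by simp
  have bnd: "fst p \<le> k" "snd p \<le> n - k" if "p \<in> ?X" for p
    using that unfolding theta_index_def by auto
  have "ev2 (\<Sum>p\<in>?X. of_int (a p) * ?T p) = 0" unfolding zero by simp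
  then have "(\<Sum>p\<in>?X. a p) * 2 ^ n = 0" by (simp add: ev2_tutte sum_distrib_right)
  then have sum0: "(\<Sum>p\<in>?X. a p) = 0" by simp
  have "0 = ?uv * (\<Sum>p\<in>?X. of_int (a p) * ?T p)" unfolding zero by simp
  also have "\<dots> = (\<Sum>p\<in>?X. of_int (a p) * (?uv * ?T p))"
    unfolding sum_distrib_left by (intro sum.cong refl) (simp only: mult.left_commute)
  also have "\<dots> = (\<Sum>p\<in>?X. of_int (a p) * (?uv * (xvar ^ k * yvar ^ (n - k)) + (1 - ?uv) * ?W p))"
  proof (intro sum.cong refl)
    fix p assume "p \<in> ?X"
    then show "of_int (a p) * (?uv * ?T p) =
        of_int (a p) * (?uv * (xvar ^ k * yvar ^ (n - k)) + (1 - ?uv) * ?W p)"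
      using tutte_std_theta[OF k bnd(1) bnd(2), of p p] by (simp only: prod.collapse)
  qed
  also have "\<dots> = of_int (\<Sum>p\<in>?X. a p) * (?uv * (xvar ^ k * yvar ^ (n - k))) +
      (1 - ?uv) * (\<Sum>p\<in>?X. of_int (a p) * ?W p)"
    unfolding of_int_sum sum_distrib_left sum_distrib_right sum.distrib[symmetric]
    by (intro sum.cong refl) (simp only: distrib_left mult.left_commute)
  finally have W0: "(\<Sum>p\<in>?X. of_int (a p) * ?W p) = 0"
    using weight_neq_0 unfolding sum0 by simp
  have nonzero: "a (r, m) = 0" if rm: "1 \<le> r" "r \<le> k" "1 \<le> m" "m \<le> n - k" for r m
  proof -
    have W: "?W p = xvar ^ k * yvar ^ (n - k) - xvar ^ k * yvar ^ (n - k - snd p)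
        - xvar ^ (k - fst p) * yvar ^ (n - k) + xvar ^ (k - fst p) * yvar ^ (n - k - snd p)" for p
      by (simp add: algebra_simps)
    have "coeff (coeff (?W p) (n - k - m)) (k - r) = of_bool (p = (r, m))" if "p \<in> ?X" for p
    proof -
      have "k - r \<noteq> k" "n - k - m \<noteq> n - k" using rm by auto
      moreover have "k - r = k - fst p \<longleftrightarrow> fst p = r" "n - k - m = n - k - snd p \<longleftrightarrow> snd p = m"
        using bnd[OF that] rm by auto
      ultimately show ?thesis unfolding W
        by (simp only: coeff_add coeff_diff coeff_xvar_yvar) (auto simp: prod_eq_iff)
    qed
    then have "coeff (coeff (\<Sum>p\<in>?X. of_int (a p) * ?W p) (n - k - m)) (k - r) =
        (\<Sum>p\<in>?X. a p * of_bool (p = (r, m)))"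
      unfolding coeff_sum coeff_of_int_mult by (intro sum.cong refl) simp
    also have "\<dots> = (\<Sum>p\<in>?X. if p = (r, m) then a p else 0)"
      by (intro sum.cong refl) auto
    also have "\<dots> = a (r, m)"
      using fin rm unfolding theta_index_def by simp
    finally show ?thesis unfolding W0 by simp
  qed
  have rest: "a q = 0" if "q \<in> {1..k} \<times> {1..n - k}" for q
    using that nonzero by (cases q) auto
  moreover have "(0, 0) \<notin> {1..k} \<times> {1..n - k}" by simp
  \<comment> \<open>\<open>?W (0, 0)\<close> vanishes, so the last coefficient has to be recovered
    from the coefficient sum.\<close>
  ultimately have "(\<Sum>p\<in>?X. a p) = a (0, 0)"
    unfolding theta_index_def by (subst sum.insert) simp_all
  then show ?thesis using sum0 rest p unfolding theta_index_def by auto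
qed

section \<open>Integer span of the differences of Tutte polynomials\<close>

text \<open>With \<open>w = 1 - (x - 1)(y - 1)\<close>, the differences \<open>T\<^bsub>(r, m)\<^esub> - T\<^bsub>(0, 0)\<^esub>\<close> span exactly the polynomials
  \<open>w q\<close> with \<open>q\<close> of degree less than \<open>k\<close> in \<open>x\<close> and less than \<open>n - k\<close> in \<open>y\<close>.\<close>
definition diff_span :: "nat \<Rightarrow> nat \<Rightarrow> int poly poly \<Rightarrow> bool" where
  "diff_span n k p \<longleftrightarrow> (\<exists>a :: nat \<times> nat \<Rightarrow> int. p = (\<Sum>q\<in>{1..k} \<times> {1..n - k}.
     of_int (a q) * (tutte n (std_theta n k q) - tutte n (std_theta n k (0, 0)))))"

lemma diff_span_0: "diff_span n k 0"
  unfolding diff_span_def by (intro exI[of _ "\<lambda>_. 0"]) simp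

lemma diff_span_add: "diff_span n k p \<Longrightarrow> diff_span n k q \<Longrightarrow> diff_span n k (p + q)"
  unfolding diff_span_def
proof (elim exE)
  fix a b :: "nat \<times> nat \<Rightarrow> int"
  let ?D = "\<lambda>q. tutte n (std_theta n k q) - tutte n (std_theta n k (0, 0))"
  let ?X = "{1..k} \<times> {1..n - k}"
  assume "p = (\<Sum>q\<in>?X. of_int (a q) * ?D q)" "q = (\<Sum>q\<in>?X. of_int (b q) * ?D q)"
  then have "p + q = (\<Sum>q\<in>?X. of_int (a q + b q) * ?D q)"
    by (simp only: of_int_add distrib_right sum.distrib)
  then show "\<exists>a. p + q = (\<Sum>q\<in>?X. of_int (a q) * ?D q)" by (intro exI)
qed

lemma diff_span_uminus: "diff_span n k p \<Longrightarrow> diff_span n k (- p)"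
  unfolding diff_span_def
proof (elim exE)
  fix a :: "nat \<times> nat \<Rightarrow> int"
  let ?D = "\<lambda>q. tutte n (std_theta n k q) - tutte n (std_theta n k (0, 0))"
  let ?X = "{1..k} \<times> {1..n - k}"
  assume "p = (\<Sum>q\<in>?X. of_int (a q) * ?D q)"
  then have "- p = (\<Sum>q\<in>?X. of_int (- a q) * ?D q)"
    by (simp only: of_int_minus mult_minus_left sum_negf)
  then show "\<exists>a. - p = (\<Sum>q\<in>?X. of_int (a q) * ?D q)" by (intro exI)
qed

lemma diff_span_diff: "diff_span n k p \<Longrightarrow> diff_span n k q \<Longrightarrow> diff_span n k (p - q)"
  using diff_span_add[OF _ diff_span_uminus] by simp

lemma diff_span_sum: "(\<And>a. a \<in> A \<Longrightarrow> diff_span n k (f a)) \<Longrightarrow> diff_span n k (sum f A)"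
  by (induction A rule: infinite_finite_induct) (auto intro: diff_span_0 diff_span_add)

lemma uv_mult_std_theta_diff:
  assumes "k \<le> n" "r \<le> k" "m \<le> n - k"
  shows "(xvar - 1) * (yvar - 1) * (tutte n (std_theta n k (r, m)) - tutte n (std_theta n k (0, 0))) =
    (1 - (xvar - 1) * (yvar - 1)) *
      ((xvar ^ k - xvar ^ (k - r)) * (yvar ^ (n - k) - yvar ^ (n - k - m)))"
  unfolding right_diff_distrib[of "(xvar - 1) * (yvar - 1)"] tutte_std_theta[OF assms]
    tutte_std_theta[OF assms(1) le0 le0] by simp

text \<open>Includes the degenerate shapes with \<open>r = 0\<close> or \<open>m = 0\<close>, whose
  difference is 0: they occur as border terms of the mixed differences below.\<close>

lemma diff_span_std_theta:
  assumes k: "k \<le> n" "r \<le> k" "m \<le> n - k"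
  shows "diff_span n k (tutte n (std_theta n k (r, m)) - tutte n (std_theta n k (0, 0)))"
proof (cases "r = 0 \<or> m = 0")
  case True
  then have "(xvar - 1) * (yvar - 1) * (tutte n (std_theta n k (r, m)) - tutte n (std_theta n k (0, 0))) = 0"
    unfolding uv_mult_std_theta_diff[OF k] by auto
  then show ?thesis using xvar_neq_1 yvar_neq_1 by (simp add: diff_span_0)
next
  case False
  let ?X = "{1..k} \<times> {1..n - k}"
  have "f (r, m) = (\<Sum>q\<in>?X. of_int (of_bool (q = (r, m))) * f q)" for f :: "_ \<Rightarrow> int poly poly"
  proof -
    have "(\<Sum>q\<in>?X. of_int (of_bool (q = (r, m))) * f q) = (\<Sum>q\<in>?X. if q = (r, m) then f q else 0)"
      by (intro sum.cong refl) auto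
    then show ?thesis using False k by simp
  qed
  then show ?thesis unfolding diff_span_def by (intro exI[of _ "\<lambda>q. of_bool (q = (r, m))"])
qed

text \<open>Corner sums are two-dimensional partial sums of monomials, so the mixed second
  difference over four neighbouring shapes isolates one monomial, with coefficients 1 and
  -1.\<close>

lemma diff_span_weight_monom:
  assumes k: "k \<le> n" and i: "i < k" and j: "j < n - k"
  shows "diff_span n k ((1 - (xvar - 1) * (yvar - 1)) * (xvar ^ i * yvar ^ j))"
proof -
  let ?uv = "(xvar - 1) * (yvar - 1)" and ?l = "n - k"
  define D where "D r m = tutte n (std_theta n k (r, m)) - tutte n (std_theta n k (0, 0))" for r m
  have D: "?uv * D r m = (1 - ?uv) * ((xvar ^ k - xvar ^ (k - r)) * (yvar ^ ?l - yvar ^ (?l - m)))"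
    if "r \<le> k" "m \<le> ?l" for r m
    unfolding D_def by (rule uv_mult_std_theta_diff[OF k that])
  have e: "k - (k - i) = i" "k - (k - Suc i) = Suc i" "?l - (?l - j) = j" "?l - (?l - Suc j) = Suc j"
    using i j by auto
  \<comment> \<open>With \<open>r = k - i\<close> the powers of \<open>x\<close> run from
    \<open>x^i\<close> to \<open>x^(k-1)\<close>; with \<open>Suc i\<close> in place of
    \<open>i\<close> the lowest one is dropped. The same holds for \<open>y\<close> and
    \<open>j\<close>.\<close>
  let ?c = "D (k - i) (?l - j) - D (k - Suc i) (?l - j) - D (k - i) (?l - Suc j) + D (k - Suc i) (?l - Suc j)"
  define X Y X' Y' w where defs: "X = xvar ^ i" "Y = yvar ^ j" "X' = xvar ^ k" "Y' = yvar ^ ?l" "w = 1 - ?uv"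
  have "?uv * ?c = w * ((X' - X) * (Y' - Y)) - w * ((X' - xvar * X) * (Y' - Y))
      - w * ((X' - X) * (Y' - yvar * Y)) + w * ((X' - xvar * X) * (Y' - yvar * Y))"
    unfolding distrib_left[of ?uv] right_diff_distrib[of ?uv] D[OF diff_le_self diff_le_self] e defs by simp
  also have "\<dots> = ?uv * (w * (X * Y))" by (simp add: algebra_simps)
  finally have "?c = w * (X * Y)" using xvar_neq_1 yvar_neq_1 by simp
  moreover have "diff_span n k ?c"
    unfolding D_def by (intro diff_span_add diff_span_diff diff_span_std_theta[OF k]) auto
  ultimately show ?thesis unfolding defs by simp
qed

text \<open>Passes from powers of \<open>x\<close> and \<open>y\<close> to powers of
  \<open>x - 1\<close> and \<open>y - 1\<close>. One factor at a time is split as a difference,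
  which respects the degree bounds.\<close>

lemma diff_span_weight_mixed:
  assumes k: "k \<le> n" and "i + a < k" "j + b < n - k"
  shows "diff_span n k ((1 - (xvar - 1) * (yvar - 1)) * (xvar ^ i * (xvar - 1) ^ a * (yvar ^ j * (yvar - 1) ^ b)))"
  using assms(2,3)
proof (induction a arbitrary: i)
  case 0
  from 0(2) show ?case
  proof (induction b arbitrary: j)
    case 0
    then show ?case using diff_span_weight_monom[OF k, of i j] \<open>i + 0 < k\<close> by simp
  next
    case (Suc b)
    let ?w = "1 - (xvar - 1) * (yvar - 1)"
    have "diff_span n k (?w * (xvar ^ i * (xvar - 1) ^ 0 * (yvar ^ Suc j * (yvar - 1) ^ b))
        - ?w * (xvar ^ i * (xvar - 1) ^ 0 * (yvar ^ j * (yvar - 1) ^ b)))"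
      using Suc.prems by (intro diff_span_diff Suc.IH) auto
    moreover have "w * (q * (yvar ^ Suc j * (yvar - 1) ^ b)) - w * (q * (yvar ^ j * (yvar - 1) ^ b)) =
        w * (q * (yvar ^ j * (yvar - 1) ^ Suc b))" for w q
      by (simp add: algebra_simps)
    ultimately show ?case by (simp only:)
  qed
next
  case (Suc a)
  let ?w = "1 - (xvar - 1) * (yvar - 1)" and ?y = "yvar ^ j * (yvar - 1) ^ b"
  have "diff_span n k (?w * (xvar ^ Suc i * (xvar - 1) ^ a * ?y) - ?w * (xvar ^ i * (xvar - 1) ^ a * ?y))"
    using Suc.prems by (intro diff_span_diff Suc.IH) auto
  moreover have "w * (xvar ^ Suc i * (xvar - 1) ^ a * q) - w * (xvar ^ i * (xvar - 1) ^ a * q) =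
      w * (xvar ^ i * (xvar - 1) ^ Suc a * q)" for w q
    by (simp add: algebra_simps)
  ultimately show ?case by (simp only:)
qed

text \<open>Telescoping: raising \<open>d\<close> by one adds
  \<open>(1 - u v) u^(a+d) v^(b+d)\<close>, whose exponents stay strictly below the bounds.\<close>

lemma diff_span_power_diff:
  assumes k: "k \<le> n" and "a + d \<le> k" "b + d \<le> n - k"
  shows "diff_span n k ((xvar - 1) ^ a * (yvar - 1) ^ b - (xvar - 1) ^ (a + d) * (yvar - 1) ^ (b + d))"
  using assms(2,3)
proof (induction d)
  case 0
  then show ?case by (simp add: diff_span_0)
next
  case (Suc d)
  let ?p = "(xvar - 1) ^ (a + d)" and ?q = "(yvar - 1) ^ (b + d)" and ?w = "1 - (xvar - 1) * (yvar - 1)"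
  have "diff_span n k (?w * (xvar ^ 0 * ?p * (yvar ^ 0 * ?q)))"
    using Suc.prems by (intro diff_span_weight_mixed[OF k]) auto
  moreover have "diff_span n k ((xvar - 1) ^ a * (yvar - 1) ^ b - ?p * ?q)"
    using Suc by simp
  ultimately have "diff_span n k (((xvar - 1) ^ a * (yvar - 1) ^ b - ?p * ?q) + ?w * (xvar ^ 0 * ?p * (yvar ^ 0 * ?q)))"
    using diff_span_add by blast
  moreover have "(1 - u * v) * (xvar ^ 0 * p * (yvar ^ 0 * q)) = p * q - u * p * (v * q)"
    for u v p q by (simp add: algebra_simps)
  ultimately show ?case by simp
qed

text \<open>Two rank functions differ on \<open>A\<close> by some \<open>d\<close>, so the two summands differ by the factor
  \<open>((x - 1)(y - 1))\<^sup>d\<close>.\<close>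
lemma diff_span_tutte_diff:
  assumes k: "k \<le> n"
    and M: "matroid n M" "matroid_rank n M = k" and M': "matroid n M'" "matroid_rank n M' = k"
  shows "diff_span n k (tutte n M - tutte n M')"
proof -
  define t where "t J A = (xvar - 1) ^ (k - mrank J A) * (yvar - 1) ^ (card A - mrank J A)" for J A
  have T: "tutte n J = (\<Sum>A\<in>Pow {..<n}. t J A)" if "matroid_rank n J = k" for J
    using that unfolding tutte_xvar_yvar matroid_rank_def t_def by simp
  have bounds: "mrank J A \<le> k" "mrank J A \<le> card A" "card A - mrank J A \<le> n - k"
    if "matroid n J" "matroid_rank n J = k" "A \<subseteq> {..<n}" for J A
    using mrank_mono[OF that(1,3)] mrank_le_card[OF that(1,3)] nullity_bound[OF that(1,3)] that(2)
    unfolding matroid_rank_def by auto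
  have le: "diff_span n k (t J A - t J' A)"
    if J: "matroid n J" "matroid_rank n J = k" "matroid n J'" "matroid_rank n J' = k"
      and A: "A \<subseteq> {..<n}" and le: "mrank J' A \<le> mrank J A" for J J' A
  proof -
    let ?d = "mrank J A - mrank J' A"
    have e: "k - mrank J' A = k - mrank J A + ?d" "card A - mrank J' A = card A - mrank J A + ?d"
      using bounds[OF J(1,2) A] le by linarith+
    have "k - mrank J A + ?d \<le> k" "card A - mrank J A + ?d \<le> n - k"
      using bounds(3)[OF J(3,4) A] e by linarith+
    from diff_span_power_diff[OF k this] show ?thesis unfolding t_def e .
  qed
  have "diff_span n k (t M A - t M' A)" if "A \<subseteq> {..<n}" for A
  proof (cases "mrank M' A \<le> mrank M A")
    case True
    then show ?thesis by (rule le[OF M M' that])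
  next
    case False
    then have "diff_span n k (- (t M' A - t M A))"
      by (intro diff_span_uminus le[OF M' M that]) simp
    then show ?thesis by (simp only: minus_diff_eq)
  qed
  then have "diff_span n k (\<Sum>A\<in>Pow {..<n}. t M A - t M' A)" by (intro diff_span_sum) auto
  then show ?thesis unfolding T[OF M(2)] T[OF M'(2)] by (simp add: sum_subtractf)
qed

lemma tutte_in_std_theta_span:
  assumes k: "k \<le> n" and M: "matroid n M" "matroid_rank n M = k"
  obtains a :: "nat \<times> nat \<Rightarrow> int"
  where "tutte n M = (\<Sum>p\<in>theta_index n k. of_int (a p) * tutte n (std_theta n k p))"
proof -
  let ?T = "\<lambda>p. tutte n (std_theta n k p)" and ?X = "{1..k} \<times> {1..n - k}"
  have "matroid n (std_theta n k (0, 0))"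
    using matroid_theta[OF std_theta_parts[OF k le0 le0]] by (simp add: std_theta_def)
  then have "diff_span n k (tutte n M - ?T (0, 0))"
    using diff_span_tutte_diff[OF k M] matroid_rank_std_theta[OF k le0 le0] by blast
  then obtain a :: "nat \<times> nat \<Rightarrow> int" where
    a: "tutte n M - ?T (0, 0) = (\<Sum>q\<in>?X. of_int (a q) * (?T q - ?T (0, 0)))"
    unfolding diff_span_def by blast
  \<comment> \<open>The coefficient at \<open>(0, 0)\<close> combines the reference polynomial
    itself with the copies of it that the differences subtract.\<close>
  define b where "b p = (if p = (0, 0) then 1 - (\<Sum>q\<in>?X. a q) else a p)" for p
  have "(\<Sum>q\<in>?X. of_int (b q) * ?T q) = (\<Sum>q\<in>?X. of_int (a q) * ?T q)"
    by (intro sum.cong refl) (auto simp: b_def)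
  then have "(\<Sum>p\<in>theta_index n k. of_int (b p) * ?T p) =
      of_int (1 - (\<Sum>q\<in>?X. a q)) * ?T (0, 0) + (\<Sum>q\<in>?X. of_int (a q) * ?T q)"
    unfolding theta_index_def by (subst sum.insert) (simp_all add: b_def)
  also have "\<dots> = ?T (0, 0) + (\<Sum>q\<in>?X. of_int (a q) * (?T q - ?T (0, 0)))"
    by (simp only: of_int_diff of_int_1 of_int_sum right_diff_distrib left_diff_distrib sum_subtractf
        sum_distrib_right)
  also have "\<dots> = tutte n M" using a[symmetric] by simp
  finally show ?thesis using that by metis
qed

section \<open>Matching representatives with shapes\<close>

lemma std_theta_tutte_inj:
  assumes k: "k \<le> n" and p: "p \<in> theta_index n k" and q: "q \<in> theta_index n k"
    and eq: "tutte n (std_theta n k p) = tutte n (std_theta n k q)"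
  shows "p = q"
proof (rule ccontr)
  assume ne: "p \<noteq> q"
  let ?X = "theta_index n k" and ?T = "\<lambda>p. tutte n (std_theta n k p)"
  let ?a = "\<lambda>x. (if x = p then 1 else 0) - (if x = q then 1 else 0) :: int"
  have fin: "finite ?X" unfolding theta_index_def by simp
  have "(\<Sum>x\<in>?X. of_int (?a x) * ?T x) =
      (\<Sum>x\<in>?X. (if x = p then ?T x else 0) - (if x = q then ?T x else 0))"
    by (intro sum.cong refl) auto
  also have "\<dots> = 0" using fin p q eq by (simp add: sum_subtractf)
  finally show False using std_theta_tutte_independent[OF k _ p, of ?a] ne by simp
qed

lemma graphic_schubert_theta_index:
  assumes "matroid n I" "matroid_rank n I = k" "graphic n I" "schubert n I"
  obtains R P L where "theta_parts n R P L" "I = theta n R P L" "(card R, card P) \<in> theta_index n k"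
proof -
  obtain R P L where parts: "theta_parts n R P L" and I: "I = theta n R P L" and "R = {} \<longleftrightarrow> P = {}"
    using graphic_schubert_imp_theta[OF assms(1,3,4)] by metis
  moreover have "finite R" "finite P"
    using parts finite_subset[OF _ finite_lessThan] unfolding theta_parts_def by auto
  ultimately have "card R = 0 \<longleftrightarrow> card P = 0" by simp
  moreover have "card R \<le> k" "card P \<le> n - k"
    using theta_part_cards[OF parts, of k] assms(2) I by auto
  ultimately have "(card R, card P) \<in> theta_index n k" unfolding theta_index_def by auto
  then show ?thesis using that parts I by blast
qed

lemma std_theta_graphic_schubert:
  assumes k: "k \<le> n" and p: "p \<in> theta_index n k"
  shows "matroid n (std_theta n k p)" "matroid_rank n (std_theta n k p) = k"
    "graphic n (std_theta n k p)" "schubert n (std_theta n k p)"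
proof -
  have b: "fst p \<le> k" "snd p \<le> n - k" using p unfolding theta_index_def by auto
  note parts = std_theta_parts[OF k b]
  show "matroid n (std_theta n k p)" "graphic n (std_theta n k p)" "schubert n (std_theta n k p)"
    unfolding std_theta_def
    by (rule matroid_theta[OF parts], rule graphic_theta[OF b(1)], rule schubert_theta[OF parts])
  show "matroid_rank n (std_theta n k p) = k"
    using matroid_rank_std_theta[OF k b] by simp
qed

text \<open>The isomorphism carries the three parts to parts of the same sizes, and these sizes
  determine the polynomial; rank functions are never transported.\<close>

lemma tutte_matroid_iso_std_theta:
  assumes k: "k \<le> n" and p: "p \<in> theta_index n k"
    and J: "matroid n J" "matroid_rank n J = k" "matroid_iso n (std_theta n k p) J"
  shows "tutte n J = tutte n (std_theta n k p)"
proof -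
  have b: "fst p \<le> k" "snd p \<le> n - k" using p unfolding theta_index_def by auto
  note parts = std_theta_parts[OF k b]
  let ?R = "{..<fst p}" and ?P = "{k..<k + snd p}" and ?L = "{k + snd p..<n}"
  obtain f where f: "bij_betw f {..<n} {..<n}"
    "\<forall>A. A \<subseteq> {..<n} \<longrightarrow> (A \<in> theta n ?R ?P ?L \<longleftrightarrow> f ` A \<in> J)"
    using J(3) unfolding matroid_iso_def std_theta_def by blast
  have Jf: "J = theta n (f ` ?R) (f ` ?P) (f ` ?L)" by (rule matroid_iso_theta[OF f parts J(1)])
  have inj: "inj_on f {..<n}" using f(1) by (rule bij_betw_imp_inj_on)
  have "card (f ` ?R) = fst p" "card (f ` ?P) = snd p"
    using parts unfolding theta_parts_def by (simp_all add: card_image inj_on_subset[OF inj])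
  moreover have "tutte n J = tutte n (std_theta n k (card (f ` ?R), card (f ` ?P)))"
    using tutte_theta_std[OF theta_parts_image[OF f(1) parts]] J(2) Jf by simp
  ultimately show ?thesis by simp
qed

theorem theoremE:
  fixes n k s :: nat and N :: "nat \<Rightarrow> nat set set"
  assumes "k \<le> n"
    and reps: "\<forall>i<s. matroid n (N i) \<and> matroid_rank n (N i) = k \<and> graphic n (N i) \<and> schubert n (N i)"
    and distinct_classes: "\<forall>i<s. \<forall>j<s. matroid_iso n (N i) (N j) \<longrightarrow> i = j"
    and complete: "\<forall>J. matroid n J \<and> matroid_rank n J = k \<and> graphic n J \<and> schubert n J
                     \<longrightarrow> (\<exists>i<s. matroid_iso n J (N i))"
  shows "\<forall>M. matroid n M \<and> matroid_rank n M = k \<longrightarrow>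
           (\<exists>!c :: int list. length c = s \<and>
              tutte n M = (\<Sum>i<s. of_int (c ! i) * tutte n (N i)))"
proof (intro allI impI)
  fix M assume M: "matroid n M \<and> matroid_rank n M = k"
  let ?X = "theta_index n k" and ?T = "\<lambda>p. tutte n (std_theta n k p)"
  have "\<exists>R P L. theta_parts n R P L \<and> N i = theta n R P L \<and> (card R, card P) \<in> ?X" if "i < s" for i
    using graphic_schubert_theta_index[of n "N i" k] reps that by metis
  then obtain R P L where RPL: "\<And>i. i < s \<Longrightarrow> theta_parts n (R i) (P i) (L i)"
    "\<And>i. i < s \<Longrightarrow> N i = theta n (R i) (P i) (L i)" "\<And>i. i < s \<Longrightarrow> (card (R i), card (P i)) \<in> ?X"
    by metis
  define \<pi> where "\<pi> i = (card (R i), card (P i))" for i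
  have rank: "matroid_rank n (theta n (R i) (P i) (L i)) = k" if "i < s" for i
    using reps that unfolding RPL(2)[OF that, symmetric] by blast
  have TN: "tutte n (N i) = ?T (\<pi> i)" if "i < s" for i
    using tutte_theta_std[OF RPL(1)[OF that] rank[OF that]] RPL(2)[OF that] unfolding \<pi>_def by simp
  have "inj_on \<pi> {..<s}"
  proof (rule inj_onI)
    fix i j assume "i \<in> {..<s}" "j \<in> {..<s}" and eq: "\<pi> i = \<pi> j"
    then have ij: "i < s" "j < s" by auto
    have c: "card (R i) = card (R j)" "card (P i) = card (P j)" using eq unfolding \<pi>_def by auto
    moreover have "card (L i) = card (L j)"
      using theta_part_cards(2)[OF RPL(1)[OF ij(1)] rank[OF ij(1)]]
        theta_part_cards(2)[OF RPL(1)[OF ij(2)] rank[OF ij(2)]] c by simp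
    ultimately have "matroid_iso n (N i) (N j)"
      using matroid_iso_theta_theta[OF RPL(1)[OF ij(1)] RPL(1)[OF ij(2)]] RPL(2) ij by simp
    then show "i = j" using distinct_classes ij by blast
  qed
  moreover have "\<pi> ` {..<s} = ?X"
  proof
    show "\<pi> ` {..<s} \<subseteq> ?X" using RPL(3) unfolding \<pi>_def by auto
    show "?X \<subseteq> \<pi> ` {..<s}"
    proof
      fix p assume p: "p \<in> ?X"
      obtain i where i: "i < s" "matroid_iso n (std_theta n k p) (N i)"
        using complete std_theta_graphic_schubert[OF \<open>k \<le> n\<close> p] by blast
      \<comment> \<open>The shape chosen for \<open>N i\<close> is identified with \<open>p\<close>
        through the Tutte polynomial, since different shapes have different polynomials.\<close>
      have "?T p = ?T (\<pi> i)"
        using tutte_matroid_iso_std_theta[OF \<open>k \<le> n\<close> p _ _ i(2)] reps i(1) TN[OF i(1)] by simp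
      then have "p = \<pi> i"
        using std_theta_tutte_inj[OF \<open>k \<le> n\<close> p] RPL(3)[OF i(1)] unfolding \<pi>_def by blast
      then show "p \<in> \<pi> ` {..<s}" using i(1) by blast
    qed
  qed
  ultimately have bij: "bij_betw \<pi> {..<s} ?X" unfolding bij_betw_def by blast
  have reindex: "(\<Sum>i<s. of_int (c (\<pi> i)) * tutte n (N i)) = (\<Sum>p\<in>?X. of_int (c p) * ?T p)"
    for c :: "nat \<times> nat \<Rightarrow> int"
  proof -
    have "(\<Sum>i<s. of_int (c (\<pi> i)) * tutte n (N i)) = (\<Sum>i<s. of_int (c (\<pi> i)) * ?T (\<pi> i))"
      using TN by (intro sum.cong refl) simp
    then show ?thesis using sum.reindex_bij_betw[OF bij, of "\<lambda>p. of_int (c p) * ?T p"] by simp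
  qed
  obtain a :: "nat \<times> nat \<Rightarrow> int" where a: "tutte n M = (\<Sum>p\<in>?X. of_int (a p) * ?T p)"
    using tutte_in_std_theta_span[OF \<open>k \<le> n\<close>] M by blast
  show "\<exists>!c :: int list. length c = s \<and> tutte n M = (\<Sum>i<s. of_int (c ! i) * tutte n (N i))"
  proof (rule ex1I[of _ "map (\<lambda>i. a (\<pi> i)) [0..<s]"])
    show "length (map (\<lambda>i. a (\<pi> i)) [0..<s]) = s \<and>
      tutte n M = (\<Sum>i<s. of_int (map (\<lambda>i. a (\<pi> i)) [0..<s] ! i) * tutte n (N i))"
      using a reindex[of a] by simp
  next
    fix c :: "int list"
    assume c: "length c = s \<and> tutte n M = (\<Sum>i<s. of_int (c ! i) * tutte n (N i))"
    \<comment> \<open>Transports the list along \<open>\<pi>\<close> to a coefficient function on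
      shapes, where independence applies.\<close>
    let ?b = "\<lambda>p. c ! the_inv_into {..<s} \<pi> p"
    have b: "?b (\<pi> i) = c ! i" if "i < s" for i
      using the_inv_into_f_f[OF bij_betw_imp_inj_on[OF bij], of i] that by simp
    have "(\<Sum>p\<in>?X. of_int (?b p) * ?T p) = tutte n M"
      using c b reindex[of ?b] by simp
    then have "(\<Sum>p\<in>?X. of_int (?b p - a p) * ?T p) = 0"
      using a by (simp only: of_int_diff left_diff_distrib sum_subtractf)
    then have "?b p = a p" if "p \<in> ?X" for p
      using std_theta_tutte_independent[OF \<open>k \<le> n\<close> _ that, of "\<lambda>p. ?b p - a p"] by simp
    then have "c ! i = a (\<pi> i)" if "i < s" for i
      using b[OF that] RPL(3)[OF that] that unfolding \<pi>_def by metis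
    then show "c = map (\<lambda>i. a (\<pi> i)) [0..<s]" using c by (intro nth_equalityI) auto
  qed
qed

end
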